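(* Let $G^N=(V(G^N),E(G^N),\mu^N)$, $N\in\mathbb{N}$, be a sequence of random weighted graphs (setting and notation as in the context). (1) Suppose there exist constants $c_1,c_2>0$ and functions $v,r:\mathbb{N}\to[0,\infty)$ with $\lim_{N\to\infty}v(N)=\infty$ such that, with high probability, $$\log|V(G^N)|\le c_1\log v(N)\quad\text{and}\quad \mathrm{diam}_R(G^N)\le c_2 r(N).$$ Then there exists $c_3>0$ such that, with high probability, $t_{\mathrm{cov}}(G^N)/\mu^N(G^N)\le c_3\, r(N)\log v(N)$. (2) Suppose there exist constants $c_4,c_5>0$ and functions $v,r:\mathbb{N}\to[0,\infty)$ with $\lim_{N\to\infty}v(N)=\infty$ such that, with high probability, $$\log\{n_{\mathrm{pac}}(G^N,c_4 r(N))\}\ge c_5\log v(N).$$ Then there exists $c_6>0$ such that, with high probability, $t_{\mathrm{cov}}(G^N)/\mu^N(G^N)\ge c_6\, r(N)\log v(N)$. (3) If there exist constants $c_1,c_2,c_4,c_5>0$ and functions $v,r$ with $\lim_{N\to\infty}v(N)=\infty$ such that both the hypotheses of (1) and of (2) hold (for the same $v,r$), then the sequence $(t_{\mathrm{cov}}(G^N))_{N\in\mathbb{N}}$ is of Type 1.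
   Context: For each $N\in\mathbb{N}$, $G^N=(V(G^N),E(G^N),\mu^N)$ is a random weighted graph, all defined on a common probability space with probability measure $\mathbf{P}$; $\mu^N$ is a non-negative symmetric function on $V(G^N)\times V(G^N)$ with $\mu^N_{xy}>0$ iff $\{x,y\}\in E(G^N)$, and $G^N$ is finite and connected $\mathbf{P}$-a.s. Volume: $\mu^N(G^N):=\sum_{x,y\in V(G^N)}\mu^N_{xy}$. Effective resistance: for $x\neq y$, $R^N_{\mathrm{eff}}(x,y)^{-1}:=\inf\{\mathcal{E}^N(f,f): f:V(G^N)\to\mathbb{R}, f(x)=1,f(y)=0\}$ where $\mathcal{E}^N(f,g)=\frac12\sum_{\{u,v\}\in E(G^N)}\mu^N_{uv}(f(u)-f(v))(g(u)-g(v))$ (sum over ordered pairs $u,v$ with $\{u,v\}\in E(G^N)$), and $R^N_{\mathrm{eff}}(x,x)=0$; this is a metric. $\mathrm{diam}_R(G^N):=\max_{x,y}R^N_{\mathrm{eff}}(x,y)$. Resistance ball $B^N_{\mathrm{eff}}(x,r):=\{y: R^N_{\mathrm{eff}}(x,y)\le r\}$. Packing number $n_{\mathrm{pac}}(G^N,r)$: the maximal $m\ge1$ such that there exist $x_1,\dots,x_m\in V(G^N)$ with $B^N_{\mathrm{eff}}(x_1,r),\dots,B^N_{\mathrm{eff}}(x_m,r)$ pairwise disjoint. The random walk on $G^N$ is the discrete-time Markov chain with transition probabilities $p(x,y)=\mu^N_{xy}/\mu^N_x$, $\mu^N_x=\sum_y\mu^N_{xy}$. With $\tau_{\mathrm{cov}}(G^N)$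 the first time all vertices have been visited and $\tau_y$ the hitting time of $y$: $t_{\mathrm{cov}}(G^N):=\max_x E^x\tau_{\mathrm{cov}}(G^N)$, $t_{\mathrm{hit}}(G^N):=\max_{x,y}E^x\tau_y$. A sequence of events $B_N$ holds with high probability if $\lim_{N\to\infty}\mathbf{P}(B_N)=1$. The sequence $(t_{\mathrm{cov}}(G^N))_N$ is of Type 1 if $\lim_{\lambda\to\infty}\liminf_{N\to\infty}\mathbf{P}\big(\lambda^{-1}\le \frac{t_{\mathrm{cov}}(G^N)}{t_{\mathrm{hit}}(G^N)\log|V(G^N)|}\le 2\big)=1$. *)

theory Defs
  imports "HOL-Probability.Probability"
begin

text \<open>A weighted graph is given by a vertex set V and a conductance function mu
  (mu x y > 0 iff {x,y} is an edge). Only values of mu on V \<times> V are used.\<close>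

definition graph_connected :: "'v set \<Rightarrow> ('v \<Rightarrow> 'v \<Rightarrow> real) \<Rightarrow> bool" where
  "graph_connected V mu \<longleftrightarrow>
     (\<forall>x\<in>V. \<forall>y\<in>V. (x, y) \<in> {(a, b). a \<in> V \<and> b \<in> V \<and> mu a b > 0}\<^sup>*)"

definition graph_volume :: "'v set \<Rightarrow> ('v \<Rightarrow> 'v \<Rightarrow> real) \<Rightarrow> real" where
  "graph_volume V mu = (\<Sum>x\<in>V. \<Sum>y\<in>V. mu x y)"

text \<open>Dirichlet energy: 1/2 sum over ordered pairs (mu vanishes off edges).\<close>
definition energy :: "'v set \<Rightarrow> ('v \<Rightarrow> 'v \<Rightarrow> real) \<Rightarrow> ('v \<Rightarrow> real) \<Rightarrow> real" where
  "energy V mu f = (1/2) * (\<Sum>u\<in>V. \<Sum>w\<in>V. mu u w * (f u - f w)^2)"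

definition R_eff :: "'v set \<Rightarrow> ('v \<Rightarrow> 'v \<Rightarrow> real) \<Rightarrow> 'v \<Rightarrow> 'v \<Rightarrow> real" where
  "R_eff V mu x y =
     (if x = y then 0 else 1 / Inf {energy V mu f | f. f x = 1 \<and> f y = 0})"

definition diam_R :: "'v set \<Rightarrow> ('v \<Rightarrow> 'v \<Rightarrow> real) \<Rightarrow> real" where
  "diam_R V mu = Max {R_eff V mu x y | x y. x \<in> V \<and> y \<in> V}"

definition ball_eff :: "'v set \<Rightarrow> ('v \<Rightarrow> 'v \<Rightarrow> real) \<Rightarrow> 'v \<Rightarrow> real \<Rightarrow> 'v set" where
  "ball_eff V mu x r = {y \<in> V. R_eff V mu x y \<le> r}"

definition n_pac :: "'v set \<Rightarrow> ('v \<Rightarrow> 'v \<Rightarrow> real) \<Rightarrow> real \<Rightarrow> nat" where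
  "n_pac V mu r = Max {m. m \<ge> 1 \<and> (\<exists>xs :: nat \<Rightarrow> 'v. (\<forall>i<m. xs i \<in> V) \<and>
        (\<forall>i<m. \<forall>j<m. i \<noteq> j \<longrightarrow> ball_eff V mu (xs i) r \<inter> ball_eff V mu (xs j) r = {}))}"

text \<open>Random walk: transition probabilities p(a,b) = mu a b / mu_a.\<close>
definition trans_prob :: "'v set \<Rightarrow> ('v \<Rightarrow> 'v \<Rightarrow> real) \<Rightarrow> 'v \<Rightarrow> 'v \<Rightarrow> real" where
  "trans_prob V mu a b = mu a b / (\<Sum>y\<in>V. mu a y)"

text \<open>Paths X_0 ... X_n of the walk started at x (lists of length n+1).\<close>
definition walk_paths :: "'v set \<Rightarrow> 'v \<Rightarrow> nat \<Rightarrow> 'v list set" where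
  "walk_paths V x n = {xs. length xs = Suc n \<and> set xs \<subseteq> V \<and> hd xs = x}"

text \<open>P^x(X_0 ... X_n = xs).\<close>
definition path_weight :: "'v set \<Rightarrow> ('v \<Rightarrow> 'v \<Rightarrow> real) \<Rightarrow> 'v list \<Rightarrow> real" where
  "path_weight V mu xs = (\<Prod>i<length xs - 1. trans_prob V mu (xs ! i) (xs ! Suc i))"

text \<open>P^x(tau_y > n) = P^x(X_0,...,X_n all differ from y).\<close>
definition hit_tail :: "'v set \<Rightarrow> ('v \<Rightarrow> 'v \<Rightarrow> real) \<Rightarrow> 'v \<Rightarrow> 'v \<Rightarrow> nat \<Rightarrow> real" where
  "hit_tail V mu x y n = (\<Sum>xs\<in>{xs \<in> walk_paths V x n. y \<notin> set xs}. path_weight V mu xs)"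

text \<open>E^x tau_y = sum_n P^x(tau_y > n).\<close>
definition exp_hit :: "'v set \<Rightarrow> ('v \<Rightarrow> 'v \<Rightarrow> real) \<Rightarrow> 'v \<Rightarrow> 'v \<Rightarrow> real" where
  "exp_hit V mu x y = (\<Sum>n. hit_tail V mu x y n)"

text \<open>P^x(tau_cov > n) = P^x({X_0,...,X_n} \<noteq> V).\<close>
definition cov_tail :: "'v set \<Rightarrow> ('v \<Rightarrow> 'v \<Rightarrow> real) \<Rightarrow> 'v \<Rightarrow> nat \<Rightarrow> real" where
  "cov_tail V mu x n = (\<Sum>xs\<in>{xs \<in> walk_paths V x n. set xs \<noteq> V}. path_weight V mu xs)"

definition exp_cov :: "'v set \<Rightarrow> ('v \<Rightarrow> 'v \<Rightarrow> real) \<Rightarrow> 'v \<Rightarrow> real" where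
  "exp_cov V mu x = (\<Sum>n. cov_tail V mu x n)"

definition t_cov :: "'v set \<Rightarrow> ('v \<Rightarrow> 'v \<Rightarrow> real) \<Rightarrow> real" where
  "t_cov V mu = Max (exp_cov V mu ` V)"

definition t_hit :: "'v set \<Rightarrow> ('v \<Rightarrow> 'v \<Rightarrow> real) \<Rightarrow> real" where
  "t_hit V mu = Max {exp_hit V mu x y | x y. x \<in> V \<and> y \<in> V}"

text \<open>Inner probability (coincides with the probability for measurable events).\<close>
definition inner_prob :: "'w measure \<Rightarrow> 'w set \<Rightarrow> real" where
  "inner_prob M A = (SUP B \<in> {B \<in> sets M. B \<subseteq> A}. measure M B)"

definition whp :: "'w measure \<Rightarrow> (nat \<Rightarrow> 'w \<Rightarrow> bool) \<Rightarrow> bool" where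
  "whp M P \<longleftrightarrow> ((\<lambda>N. inner_prob M {\<omega> \<in> space M. P N \<omega>}) \<longlonglongrightarrow> 1)"

definition type1 :: "'w measure \<Rightarrow> (nat \<Rightarrow> 'w \<Rightarrow> 'v set) \<Rightarrow> (nat \<Rightarrow> 'w \<Rightarrow> 'v \<Rightarrow> 'v \<Rightarrow> real) \<Rightarrow> bool" where
  "type1 M V mu \<longleftrightarrow>
     ((\<lambda>l::real. liminf (\<lambda>N. ereal (inner_prob M {\<omega> \<in> space M.
         1 / l \<le> t_cov (V N \<omega>) (mu N \<omega>) / (t_hit (V N \<omega>) (mu N \<omega>) * ln (card (V N \<omega>))) \<and>
         t_cov (V N \<omega>) (mu N \<omega>) / (t_hit (V N \<omega>) (mu N \<omega>) * ln (card (V N \<omega>))) \<le> 2})))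
      \<longlongrightarrow> ereal 1) at_top"

end

theory Submission
  imports Defs
begin

text \<open>
  The stationary measure of the walk is the vertex conductance, so hitting times solve Poisson
  equations for the graph Laplacian. Green's formula then gives the commute time identity
  \<open>E\<^sup>x \<tau>\<^sub>y + E\<^sup>y \<tau>\<^sub>x = \<mu>(G) R(x,y)\<close>, whence the maximal hitting time is at most
  \<open>\<mu>(G) diam\<^sub>R(G)\<close>, and also that \<open>E\<^sup>x \<tau>\<^sub>y - E\<^sup>y \<tau>\<^sub>x\<close> is a difference of potentials.
  Matthews' method bounds the cover time from above by the maximal hitting time times the
  harmonic number of \<open>|V|\<close>. For the lower bound it is applied to the centers of a maximal
  packing, which have pairwise large commute times; the asymmetric parts of the hitting times
  between successively discovered centers telescope, so half the commute times suffice.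

  Matthews' method needs no random permutation of the vertices here: averaging over the removed
  vertex in the recursion for the expected cover times of subsets yields a function that
  is harmonic off the subset, to which the maximum principle applies.
\<close>

section \<open>Packings in the effective resistance metric\<close>

text \<open>Since \<open>r \<ge> 0\<close>, every center lies in its own ball. Hence disjoint balls
  have distinct centers, and no center lies in the ball of another. Distinctness also bounds the
  size of a packing by \<open>card V\<close>, so the \<open>Max\<close> in \<open>n_pac\<close> is
  attained.\<close>

lemma packing:
  fixes V :: "'v set" and mu :: "'v \<Rightarrow> 'v \<Rightarrow> real"
  assumes fin: "finite V" and "V \<noteq> {}" and "r \<ge> 0"
  obtains A where "A \<subseteq> V" "A \<noteq> {}" "card A = n_pac V mu r"
    "\<And>x y. x \<in> A \<Longrightarrow> y \<in> A \<Longrightarrow> x \<noteq> y \<Longrightarrow> R_eff V mu x y > r"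
proof -
  define P where "P m xs \<longleftrightarrow> (\<forall>i<m. xs i \<in> V) \<and> (\<forall>i<m. \<forall>j<m. i \<noteq> j \<longrightarrow>
    ball_eff V mu (xs i) r \<inter> ball_eff V mu (xs j) r = {})" for m and xs :: "nat \<Rightarrow> 'v"
  define X where "X = {m. m \<ge> 1 \<and> (\<exists>xs. P m xs)}"
  have self: "x \<in> ball_eff V mu x r" if "x \<in> V" for x
    using that \<open>r \<ge> 0\<close> by (simp add: ball_eff_def R_eff_def)
  have inj: "inj_on xs {..<m}" if "P m xs" for m xs
  proof (rule inj_onI, rule ccontr)
    fix i j assume *: "i \<in> {..<m}" "j \<in> {..<m}" "xs i = xs j" "i \<noteq> j"
    then show False using that self[of "xs i"] unfolding P_def by (metis disjoint_iff lessThan_iff)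
  qed
  have "X \<subseteq> {..card V}"
  proof
    fix m assume "m \<in> X"
    then obtain xs where xs: "P m xs" by (auto simp: X_def)
    have "card (xs ` {..<m}) \<le> card V"
      using xs fin by (intro card_mono) (auto simp: P_def)
    then show "m \<in> {..card V}" using card_image[OF inj[OF xs]] by simp
  qed
  then have "finite X" using finite_subset by blast
  moreover obtain v where "v \<in> V" using \<open>V \<noteq> {}\<close> by auto
  then have "P 1 (\<lambda>_. v)" by (simp add: P_def)
  then have "1 \<in> X" by (auto simp: X_def)
  ultimately have "Max X \<in> X" by (intro Max_in) auto
  moreover have "n_pac V mu r = Max X" by (simp add: n_pac_def X_def P_def)
  ultimately obtain xs where m: "n_pac V mu r \<ge> 1" and xs: "P (n_pac V mu r) xs"
    by (auto simp: X_def)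
  let ?A = "xs ` {..<n_pac V mu r}"
  show ?thesis
  proof (rule that[of ?A])
    show "?A \<subseteq> V" using xs by (auto simp: P_def)
    show "?A \<noteq> {}" using m by (auto simp: lessThan_empty_iff bot_nat_def[symmetric])
    show "card ?A = n_pac V mu r" using card_image[OF inj[OF xs]] by simp
    fix x y assume "x \<in> ?A" "y \<in> ?A" "x \<noteq> y"
    then obtain i j where ij: "i < n_pac V mu r" "j < n_pac V mu r" "i \<noteq> j" "x = xs i" "y = xs j"
      by auto
    then have "ball_eff V mu x r \<inter> ball_eff V mu y r = {}" "y \<in> V" using xs by (auto simp: P_def)
    then have "y \<notin> ball_eff V mu x r" using self[of y] by auto
    then show "R_eff V mu x y > r" using \<open>y \<in> V\<close> by (simp add: ball_eff_def)
  qed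
qed

lemma n_pac_le_card: "finite V \<Longrightarrow> V \<noteq> {} \<Longrightarrow> r \<ge> 0 \<Longrightarrow> n_pac V mu r \<le> card V"
  by (metis packing card_mono)

section \<open>Finite connected networks and the maximum principle\<close>

locale network =
  fixes V :: "'v set" and mu :: "'v \<Rightarrow> 'v \<Rightarrow> real"
  assumes fin: "finite V"
    and mu_nonneg: "mu x y \<ge> 0"
    and mu_sym: "mu x y = mu y x"
    and conn: "graph_connected V mu"
    and card_ge_2: "card V \<ge> 2"
begin

abbreviation p :: "'v \<Rightarrow> 'v \<Rightarrow> real" where
  "p \<equiv> trans_prob V mu"

definition deg :: "'v \<Rightarrow> real" where
  "deg x = (\<Sum>y\<in>V. mu x y)"

abbreviation vol :: real where
  "vol \<equiv> graph_volume V mu"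

text \<open>A path from \<open>x\<close> to \<open>y\<close> has to leave \<open>A\<close> along
  some edge. Connectedness enters the later arguments through this edge.\<close>

lemma escape_edge:
  assumes "x \<in> A" "A \<subseteq> V" "y \<in> V - A"
  obtains a b where "a \<in> A" "b \<in> V - A" "mu a b > 0"
proof -
  have "(x, y) \<in> {(a, b). a \<in> V \<and> b \<in> V \<and> mu a b > 0}\<^sup>*"
    using assms conn by (auto simp: graph_connected_def)
  moreover have "y \<notin> A" using assms by auto
  ultimately have "\<exists>a b. a \<in> A \<and> b \<in> V - A \<and> mu a b > 0" using \<open>x \<in> A\<close>
  proof (induction rule: converse_rtrancl_induct)
    case base then show ?case by simp
  next
    case (step a b) then show ?case by (cases "b \<in> A") auto
  qed
  then show ?thesis using that by blast
qed

lemma other_vertex: obtains y where "y \<in> V" "y \<noteq> x"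
proof -
  have "\<not> V \<subseteq> {x}" using card_ge_2 card_mono[of "{x}" V] by auto
  then show ?thesis using that by blast
qed

lemma V_nonempty: "V \<noteq> {}"
  using card_ge_2 by auto

lemma deg_pos: assumes "x \<in> V" shows "deg x > 0"
proof -
  obtain y where "y \<in> V" "y \<noteq> x" by (rule other_vertex)
  then obtain b where "b \<in> V" "mu x b > 0"
    using escape_edge[of x "{x}" y] assms by auto
  then show ?thesis unfolding deg_def
    by (intro sum_pos2[of _ b]) (auto simp: fin mu_nonneg)
qed

lemma vol_eq: "vol = sum deg V"
  by (simp add: graph_volume_def deg_def)

lemma vol_pos: "vol > 0"
  unfolding vol_eq using V_nonempty by (intro sum_pos) (auto simp: fin deg_pos)

lemma deg_times_p: "x \<in> V \<Longrightarrow> deg x * p x y = mu x y"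
  using deg_pos[of x] by (simp add: trans_prob_def deg_def)

lemma p_nonneg: "p x y \<ge> 0"
  by (simp add: trans_prob_def mu_nonneg sum_nonneg)

lemma p_pos: "x \<in> V \<Longrightarrow> mu x y > 0 \<Longrightarrow> p x y > 0"
  using deg_pos[of x] by (simp add: trans_prob_def deg_def)

lemma sum_p: "x \<in> V \<Longrightarrow> (\<Sum>y\<in>V. p x y) = 1"
  using deg_pos[of x] by (simp add: trans_prob_def deg_def sum_divide_distrib[symmetric])

lemma sum_p_const: "x \<in> V \<Longrightarrow> (\<Sum>y\<in>V. p x y * k) = k"
  by (simp add: sum_distrib_right[symmetric] sum_p)

lemma p_average_mono:
  "(\<And>y. y \<in> V \<Longrightarrow> f y \<le> g y) \<Longrightarrow> (\<Sum>y\<in>V. p x y * f y) \<le> (\<Sum>y\<in>V. p x y * g y)"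
  by (intro sum_mono mult_left_mono p_nonneg)

text \<open>If the maximum \<open>m\<close> over \<open>V\<close> exceeded \<open>M\<close>, the set
  where it is attained would miss \<open>B\<close>, and some edge would lead out of that set. At the
  inner endpoint of this edge the average over the neighbors is strictly below \<open>m\<close>,
  contradicting subharmonicity.\<close>

lemma maximum_principle:
  assumes B: "B \<subseteq> V" "B \<noteq> {}"
    and sub: "\<And>x. x \<in> V - B \<Longrightarrow> f x \<le> (\<Sum>y\<in>V. p x y * f y)"
    and bnd: "\<And>x. x \<in> B \<Longrightarrow> f x \<le> M"
    and "x \<in> V"
  shows "f x \<le> (M::real)"
proof (rule ccontr)
  assume "\<not> f x \<le> M"
  define m where "m = Max (f ` V)"
  have le_m: "f y \<le> m" if "y \<in> V" for y
    using that fin by (simp add: m_def)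
  then have "m > M" using \<open>\<not> f x \<le> M\<close> \<open>x \<in> V\<close> by force
  define A where "A = {y \<in> V. f y = m}"
  have "m \<in> f ` V" unfolding m_def using fin V_nonempty by (intro Max_in) auto
  then obtain a0 where "a0 \<in> A" by (auto simp: A_def)
  moreover obtain b0 where "b0 \<in> B" using B by auto
  moreover have "b0 \<notin> A" using bnd[OF \<open>b0 \<in> B\<close>] \<open>m > M\<close> by (auto simp: A_def)
  ultimately obtain a b where ab: "a \<in> A" "b \<in> V - A" "mu a b > 0"
    using escape_edge[of a0 A b0] B by (auto simp: A_def)
  have aV: "a \<in> V" "f a = m" using ab by (auto simp: A_def)
  have "a \<notin> B" using bnd[of a] aV \<open>m > M\<close> by auto
  have "f b < m" using ab le_m[of b] by (auto simp: A_def)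
  have "(\<Sum>y\<in>V. p a y * f y) < (\<Sum>y\<in>V. p a y * m)"
  proof (rule sum_strict_mono_ex1[OF fin])
    show "\<forall>y\<in>V. p a y * f y \<le> p a y * m"
      using le_m by (auto intro: mult_left_mono p_nonneg)
    show "\<exists>y\<in>V. p a y * f y < p a y * m"
      using ab \<open>f b < m\<close> p_pos[OF aV(1) ab(3)] by (intro bexI[of _ b]) auto
  qed
  then show False using sub[of a] aV \<open>a \<notin> B\<close> sum_p_const[of a m] by auto
qed

lemma minimum_principle:
  assumes B: "B \<subseteq> V" "B \<noteq> {}"
    and super: "\<And>x. x \<in> V - B \<Longrightarrow> f x \<ge> (\<Sum>y\<in>V. p x y * f y)"
    and bnd: "\<And>x. x \<in> B \<Longrightarrow> f x \<ge> M"
    and "x \<in> V"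
  shows "f x \<ge> (M::real)"
  using maximum_principle[OF B, of "\<lambda>x. - f x" "- M" x] super bnd \<open>x \<in> V\<close>
  by (simp add: sum_negf)

section \<open>Tails and expectations of the cover times of vertex subsets\<close>

text \<open>The probability that the walk from \<open>x\<close> has not yet seen all of
  \<open>S\<close> at time \<open>n\<close>, where time 0 counts as a visit to \<open>x\<close>.
  Hitting times are the case of a singleton and the cover time is the case \<open>S = V\<close>, so
  a single recursion governs both.\<close>

definition cover_tail :: "'v set \<Rightarrow> 'v \<Rightarrow> nat \<Rightarrow> real" where
  "cover_tail S x n = (\<Sum>xs\<in>{xs \<in> walk_paths V x n. \<not> S \<subseteq> set xs}. path_weight V mu xs)"

definition cover_time :: "'v set \<Rightarrow> 'v \<Rightarrow> real" where
  "cover_time S x = (\<Sum>n. cover_tail S x n)"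

lemma hit_tail_eq: "hit_tail V mu x y n = cover_tail {y} x n"
  by (simp add: hit_tail_def cover_tail_def)

lemma cov_tail_eq: "cov_tail V mu x n = cover_tail V x n"
  unfolding cov_tail_def cover_tail_def
  by (intro sum.cong) (auto simp: walk_paths_def)

lemma exp_hit_eq: "exp_hit V mu x y = cover_time {y} x"
  by (simp add: exp_hit_def cover_time_def hit_tail_eq)

lemma exp_cov_eq: "exp_cov V mu x = cover_time V x"
  by (simp add: exp_cov_def cover_time_def cov_tail_eq)

lemma finite_walk_paths: "finite (walk_paths V x n)"
proof -
  have "finite {xs. set xs \<subseteq> V \<and> length xs = Suc n}"
    by (rule finite_lists_length_eq[OF fin])
  then show ?thesis
    by (rule finite_subset[rotated]) (auto simp: walk_paths_def)
qed

lemma path_weight_nonneg: "path_weight V mu xs \<ge> 0"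
  by (simp add: path_weight_def prod_nonneg p_nonneg)

lemma path_weight_Cons:
  assumes "ys \<noteq> []"
  shows "path_weight V mu (x # ys) = p x (hd ys) * path_weight V mu ys"
proof -
  obtain m where m: "length ys = Suc m" using assms by (cases ys) auto
  show ?thesis using assms
    by (simp add: path_weight_def m prod.lessThan_Suc_shift hd_conv_nth del: prod.lessThan_Suc)
qed

lemma cover_tail_nonneg: "cover_tail S x n \<ge> 0"
  by (simp add: cover_tail_def sum_nonneg path_weight_nonneg)

lemma cover_tail_empty [simp]: "cover_tail {} x n = 0"
  by (simp add: cover_tail_def)

lemma cover_tail_start: "cover_tail S x n = cover_tail (S - {x}) x n"
proof -
  have "x \<in> set xs" if "xs \<in> walk_paths V x n" for xs
    using that by (cases xs) (auto simp: walk_paths_def)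
  then show ?thesis unfolding cover_tail_def by (intro sum.cong) auto
qed

lemma cover_tail_0:
  assumes "x \<in> V"
  shows "cover_tail S x 0 = (if S \<subseteq> {x} then 0 else 1)"
proof -
  have "walk_paths V x 0 = {[x]}"
    using assms by (auto simp: walk_paths_def length_Suc_conv)
  then have "{xs \<in> walk_paths V x 0. \<not> S \<subseteq> set xs} = (if S \<subseteq> {x} then {} else {[x]})"
    by auto
  then show ?thesis by (simp add: cover_tail_def path_weight_def)
qed

text \<open>Markov property at the first step. The start \<open>x\<close> is already visited, so
  only \<open>S - {x}\<close> is left to the rest of the path.\<close>

lemma cover_tail_Suc:
  assumes "x \<in> V"
  shows "cover_tail S x (Suc n) = (\<Sum>y\<in>V. p x y * cover_tail (S - {x}) y n)"
proof -
  let ?A = "\<lambda>y. {xs \<in> walk_paths V y n. \<not> S - {x} \<subseteq> set xs}"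
  have eq: "{xs \<in> walk_paths V x (Suc n). \<not> S \<subseteq> set xs} = (\<lambda>ys. x # ys) ` (\<Union>y\<in>V. ?A y)"
  proof (intro equalityI subsetI)
    fix xs assume "xs \<in> {xs \<in> walk_paths V x (Suc n). \<not> S \<subseteq> set xs}"
    then obtain ys where "xs = x # ys" "length ys = Suc n" "set ys \<subseteq> V" "\<not> S - {x} \<subseteq> set ys"
      by (cases xs) (auto simp: walk_paths_def)
    then show "xs \<in> (\<lambda>ys. x # ys) ` (\<Union>y\<in>V. ?A y)"
      by (cases ys) (auto simp: walk_paths_def)
  next
    fix xs assume "xs \<in> (\<lambda>ys. x # ys) ` (\<Union>y\<in>V. ?A y)"
    then show "xs \<in> {xs \<in> walk_paths V x (Suc n). \<not> S \<subseteq> set xs}"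
      using assms by (auto simp: walk_paths_def)
  qed
  have "cover_tail S x (Suc n) = (\<Sum>ys\<in>(\<Union>y\<in>V. ?A y). path_weight V mu (x # ys))"
    unfolding cover_tail_def eq by (subst sum.reindex) (auto simp: inj_on_def)
  also have "\<dots> = (\<Sum>y\<in>V. \<Sum>ys\<in>?A y. path_weight V mu (x # ys))"
    by (rule sum.UNION_disjoint)
      (simp_all add: fin finite_walk_paths, auto simp: walk_paths_def)
  also have "\<dots> = (\<Sum>y\<in>V. \<Sum>ys\<in>?A y. p x y * path_weight V mu ys)"
  proof (intro sum.cong refl)
    fix y ys assume "ys \<in> ?A y"
    then have "ys \<noteq> []" "hd ys = y" by (auto simp: walk_paths_def)
    then show "path_weight V mu (x # ys) = p x y * path_weight V mu ys"
      by (simp add: path_weight_Cons)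
  qed
  finally show ?thesis by (simp add: cover_tail_def sum_distrib_left)
qed

lemma cover_tail_Suc_outside:
  assumes "x \<in> V - S"
  shows "cover_tail S x (Suc n) = (\<Sum>y\<in>V. p x y * cover_tail S y n)"
  using assms by (simp add: cover_tail_Suc)

lemma cover_tail_target: "cover_tail {y} y n = 0"
  by (subst cover_tail_start) simp

lemma hit_tail_antimono:
  assumes "x \<in> V"
  shows "cover_tail {y} x (Suc n) \<le> cover_tail {y} x n"
  using assms
proof (induction n arbitrary: x)
  case 0
  show ?case
  proof (cases "x = y")
    case True then show ?thesis by (simp add: cover_tail_target)
  next
    case False
    then have "cover_tail {y} x (Suc 0) = (\<Sum>z\<in>V. p x z * cover_tail {y} z 0)"
      using 0 by (simp add: cover_tail_Suc_outside)
    also have "\<dots> \<le> (\<Sum>z\<in>V. p x z * 1)"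
      by (rule p_average_mono) (simp add: cover_tail_0)
    finally show ?thesis using False 0 sum_p by (simp add: cover_tail_0)
  qed
next
  case (Suc n)
  show ?case
  proof (cases "x = y")
    case True then show ?thesis by (simp add: cover_tail_target)
  next
    case False
    then have "x \<in> V - {y}" using Suc by simp
    then show ?thesis unfolding cover_tail_Suc_outside[OF \<open>x \<in> V - {y}\<close>, of "Suc n"]
        cover_tail_Suc_outside[OF \<open>x \<in> V - {y}\<close>, of n]
      by (intro p_average_mono Suc.IH)
  qed
qed

text \<open>The tails decrease in \<open>n\<close>, so they have a limit \<open>q\<close>. Passing
  to the limit in the first-step recursion shows that \<open>q\<close> is harmonic off
  \<open>y\<close>, and it vanishes at \<open>y\<close>; the maximum principle then forces
  \<open>q\<close> to be 0.\<close>

lemma hit_tail_tendsto_0: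
  assumes "x \<in> V" "y \<in> V"
  shows "cover_tail {y} x \<longlonglongrightarrow> 0"
proof -
  define q where "q z = lim (cover_tail {y} z)" for z
  have lim: "cover_tail {y} z \<longlonglongrightarrow> q z" if "z \<in> V" for z
  proof -
    have "decseq (cover_tail {y} z)"
      using hit_tail_antimono[OF that] by (simp add: decseq_Suc_iff)
    then have "convergent (cover_tail {y} z)"
      using decseq_convergent[of "cover_tail {y} z" 0] cover_tail_nonneg
      by (metis convergentI)
    then show ?thesis by (simp add: q_def convergent_LIMSEQ_iff)
  qed
  have "q z \<le> (\<Sum>w\<in>V. p z w * q w)" if "z \<in> V - {y}" for z
  proof -
    have "(\<lambda>n. \<Sum>w\<in>V. p z w * cover_tail {y} w n) \<longlonglongrightarrow> (\<Sum>w\<in>V. p z w * q w)"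
      by (intro tendsto_intros lim)
    then have "(\<lambda>n. cover_tail {y} z (Suc n)) \<longlonglongrightarrow> (\<Sum>w\<in>V. p z w * q w)"
      using that by (simp add: cover_tail_Suc_outside)
    moreover have "(\<lambda>n. cover_tail {y} z (Suc n)) \<longlonglongrightarrow> q z"
      using that lim by (intro LIMSEQ_Suc) auto
    ultimately show ?thesis using LIMSEQ_unique by (metis order_refl)
  qed
  moreover have "q y \<le> 0"
  proof -
    have "cover_tail {y} y = (\<lambda>_. 0)" by (simp add: fun_eq_iff cover_tail_target)
    then show ?thesis using LIMSEQ_unique[OF lim[OF \<open>y \<in> V\<close>]] by (metis order_refl tendsto_const)
  qed
  ultimately have "q x \<le> 0"
    using maximum_principle[of "{y}" q 0 x] assms by auto
  moreover have "q x \<ge> 0"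
    using lim[OF assms(1)] cover_tail_nonneg by (meson LIMSEQ_le_const)
  ultimately show ?thesis using lim[OF assms(1)] by simp
qed

text \<open>Finiteness of \<open>V\<close> gives one \<open>k\<close> at which all tails are at most
  1/2. By the first-step recursion a delay of \<open>k\<close> then halves every tail. So a partial
  sum \<open>s\<close> satisfies \<open>s \<le> c + s / 2\<close>, where \<open>c\<close> collects
  the first \<open>k\<close> terms, and therefore \<open>s \<le> 2 * c\<close>.\<close>

lemma hit_tail_summable:
  assumes "x \<in> V" "y \<in> V"
  shows "summable (cover_tail {y} x)"
proof -
  have "\<forall>\<^sub>F n in sequentially. \<forall>z\<in>V. cover_tail {y} z n < 1/2"
    by (intro eventually_ball_finite fin ballI order_tendstoD(2)[OF hit_tail_tendsto_0])
      (use assms in auto)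
  then obtain k where k: "\<And>z. z \<in> V \<Longrightarrow> cover_tail {y} z k \<le> 1/2"
    unfolding eventually_sequentially by (meson order_refl less_imp_le)
  have half: "cover_tail {y} z (k + m) \<le> 1/2 * cover_tail {y} z m" if "z \<in> V" for z m
    using that
  proof (induction m arbitrary: z)
    case 0
    then show ?case using k by (cases "z = y") (auto simp: cover_tail_target cover_tail_0)
  next
    case (Suc m)
    show ?case
    proof (cases "z = y")
      case True then show ?thesis by (simp add: cover_tail_target)
    next
      case False
      then have z: "z \<in> V - {y}" using Suc by simp
      have "cover_tail {y} z (k + Suc m) = (\<Sum>w\<in>V. p z w * cover_tail {y} w (k + m))"
        using cover_tail_Suc_outside[OF z] by simp
      also have "\<dots> \<le> (\<Sum>w\<in>V. p z w * (1/2 * cover_tail {y} w m))"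
        by (intro p_average_mono Suc.IH)
      also have "\<dots> = 1/2 * cover_tail {y} z (Suc m)"
        unfolding cover_tail_Suc_outside[OF z] sum_distrib_left by (simp add: mult_ac)
      finally show ?thesis .
    qed
  qed
  define c where "c = (\<Sum>i<k. cover_tail {y} x i)"
  have "(\<Sum>i<m. cover_tail {y} x i) \<le> 2 * c" for m
  proof -
    have mono: "(\<Sum>i<m. cover_tail {y} x i) \<le> (\<Sum>i<k+m. cover_tail {y} x i)"
      by (intro sum_mono2) (auto simp: cover_tail_nonneg)
    have "(\<Sum>i<k+m. cover_tail {y} x i) = c + (\<Sum>i<m. cover_tail {y} x (k + i))"
      unfolding c_def by (induction m) auto
    also have "(\<Sum>i<m. cover_tail {y} x (k + i)) \<le> (\<Sum>i<m. 1/2 * cover_tail {y} x i)"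
      by (intro sum_mono half assms)
    also have "\<dots> = 1/2 * (\<Sum>i<m. cover_tail {y} x i)"
      by (simp add: sum_distrib_left)
    finally show ?thesis using mono by linarith
  qed
  then show ?thesis
    using cover_tail_nonneg by (intro summableI_nonneg_bounded[of _ "2 * c"])
qed

text \<open>Union bound over the missed vertices; it transfers summability from hitting times to
  cover times.\<close>

lemma cover_tail_le_sum:
  assumes "finite S"
  shows "cover_tail S x n \<le> (\<Sum>y\<in>S. cover_tail {y} x n)"
  using assms
proof (induction S)
  case empty
  show ?case by simp
next
  case (insert y S)
  have "cover_tail (insert y S) x n \<le> cover_tail {y} x n + cover_tail S x n"
    unfolding cover_tail_def sum.inter_filter[OF finite_walk_paths] sum.distrib[symmetric]
    by (intro sum_mono) (auto simp: path_weight_nonneg)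
  then show ?case using insert by simp
qed

lemma cover_tail_mono: "S \<subseteq> T \<Longrightarrow> cover_tail S x n \<le> cover_tail T x n"
  unfolding cover_tail_def
  by (intro sum_mono2) (auto simp: finite_walk_paths path_weight_nonneg)

lemma cover_tail_summable:
  assumes "x \<in> V" "S \<subseteq> V"
  shows "summable (cover_tail S x)"
proof (rule summable_comparison_test')
  show "summable (\<lambda>n. \<Sum>y\<in>S. cover_tail {y} x n)"
    using assms by (intro summable_sum hit_tail_summable) auto
  show "norm (cover_tail S x n) \<le> (\<Sum>y\<in>S. cover_tail {y} x n)" if "n \<ge> 0" for n
    using cover_tail_le_sum[of S x n] assms fin finite_subset cover_tail_nonneg by fastforce
qed

lemma cover_time_nonneg: "x \<in> V \<Longrightarrow> S \<subseteq> V \<Longrightarrow> cover_time S x \<ge> 0"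
  unfolding cover_time_def by (intro suminf_nonneg cover_tail_summable cover_tail_nonneg)

lemma cover_time_mono:
  "x \<in> V \<Longrightarrow> S \<subseteq> T \<Longrightarrow> T \<subseteq> V \<Longrightarrow> cover_time S x \<le> cover_time T x"
  unfolding cover_time_def by (intro suminf_le cover_tail_summable cover_tail_mono) auto

lemma cover_time_empty [simp]: "cover_time {} x = 0"
  by (simp add: cover_time_def)

lemma cover_time_start: "cover_time S x = cover_time (S - {x}) x"
  unfolding cover_time_def using cover_tail_start[of S x] by presburger

lemma cover_time_outside:
  assumes "S \<subseteq> V" "S \<noteq> {}" "x \<in> V - S"
  shows "cover_time S x = 1 + (\<Sum>y\<in>V. p x y * cover_time S y)"
proof -
  have "cover_time S x = (\<Sum>n. cover_tail S x (n + 1)) + cover_tail S x 0"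
    unfolding cover_time_def using suminf_split_initial_segment[of "cover_tail S x" 1]
      cover_tail_summable assms by simp
  also have "(\<Sum>n. cover_tail S x (n + 1)) = (\<Sum>n. \<Sum>y\<in>V. p x y * cover_tail S y n)"
    using assms by (simp add: cover_tail_Suc_outside)
  also have "\<dots> = (\<Sum>y\<in>V. \<Sum>n. p x y * cover_tail S y n)"
    using assms by (intro suminf_sum summable_mult cover_tail_summable)
  also have "\<dots> = (\<Sum>y\<in>V. p x y * cover_time S y)"
    using assms unfolding cover_time_def
    by (intro sum.cong refl suminf_mult cover_tail_summable)
  also have "cover_tail S x 0 = 1"
    using assms by (auto simp: cover_tail_0)
  finally show ?thesis by simp
qed

section \<open>The Dirichlet problem for the walk\<close>

text \<open>The expectation of \<open>g\<close> at the first vertex of \<open>B\<close> that the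
  walk visits, counted as 0 if \<open>B\<close> is not reached within \<open>n\<close>
  steps.\<close>

definition dirichlet_iter :: "'v set \<Rightarrow> ('v \<Rightarrow> real) \<Rightarrow> nat \<Rightarrow> 'v \<Rightarrow> real" where
  "dirichlet_iter B g n =
     ((\<lambda>u x. if x \<in> B then g x else \<Sum>y\<in>V. p x y * u y) ^^ n) (\<lambda>x. if x \<in> B then g x else 0)"

text \<open>For nonnegative \<open>g\<close> the iterates increase from the extension of
  \<open>g\<close> by 0 and stay bounded on \<open>V\<close>. Their limit inherits the boundary
  values and, because the averages are finite sums, also harmonicity.\<close>

lemma dirichlet_problem_solvable:
  assumes "B \<subseteq> V" and g: "\<And>x. x \<in> B \<Longrightarrow> g x \<ge> 0"
  shows "\<exists>u. (\<forall>x\<in>B. u x = g x) \<and> (\<forall>x\<in>V - B. u x = (\<Sum>y\<in>V. p x y * u y))"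
proof -
  let ?u = "dirichlet_iter B g"
  have u0: "?u 0 x = (if x \<in> B then g x else 0)" for x
    by (simp add: dirichlet_iter_def)
  have uS: "?u (Suc n) x = (if x \<in> B then g x else \<Sum>y\<in>V. p x y * ?u n y)" for n x
    by (simp add: dirichlet_iter_def)
  have nonneg: "?u n x \<ge> 0" for n x
    by (induction n arbitrary: x) (auto simp: u0 uS g p_nonneg intro!: sum_nonneg)
  have mono: "?u n x \<le> ?u (Suc n) x" for n x
  proof (induction n arbitrary: x)
    case 0
    then show ?case using nonneg[of "Suc 0" x] by (auto simp: u0 uS)
  next
    case (Suc n)
    show ?case
    proof (cases "x \<in> B")
      case True then show ?thesis by (simp add: uS)
    next
      case False
      then have "?u (Suc n) x = (\<Sum>y\<in>V. p x y * ?u n y)"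
          "?u (Suc (Suc n)) x = (\<Sum>y\<in>V. p x y * ?u (Suc n) y)" by (simp_all add: uS)
      then show ?thesis using p_average_mono[OF Suc.IH] by simp
    qed
  qed
  \<comment> \<open>A sum instead of a maximum, so that empty \<open>B\<close> gives the valid bound
    0.\<close>
  define K where "K = (\<Sum>x\<in>B. g x)"
  have finB: "finite B" using \<open>B \<subseteq> V\<close> fin finite_subset by blast
  have "K \<ge> 0" using g by (simp add: K_def sum_nonneg)
  have gK: "g x \<le> K" if "x \<in> B" for x
    unfolding K_def using that finB g by (intro member_le_sum) auto
  have bnd: "?u n x \<le> K" if "x \<in> V" for n x
    using that
  proof (induction n arbitrary: x)
    case 0
    then show ?case using gK \<open>K \<ge> 0\<close> by (simp add: u0)
  next
    case (Suc n)
    have "(\<Sum>y\<in>V. p x y * ?u n y) \<le> K"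
      using p_average_mono[of "?u n" "\<lambda>_. K" x] Suc sum_p_const[of x K] by simp
    then show ?case using gK by (simp add: uS)
  qed
  define u where "u x = lim (\<lambda>n. ?u n x)" for x
  have lim: "(\<lambda>n. ?u n x) \<longlonglongrightarrow> u x" if "x \<in> V" for x
  proof -
    have "incseq (\<lambda>n. ?u n x)" using mono by (simp add: incseq_Suc_iff)
    then have "convergent (\<lambda>n. ?u n x)"
      using incseq_convergent[of "\<lambda>n. ?u n x" K] bnd[OF that] by (metis convergentI)
    then show ?thesis by (simp add: u_def convergent_LIMSEQ_iff)
  qed
  show ?thesis
  proof (intro exI[of _ u] conjI ballI)
    fix x assume "x \<in> B"
    then have "?u n x = g x" for n by (cases n) (simp_all add: u0 uS)
    then show "u x = g x" using LIMSEQ_unique[OF lim[of x], of "g x"] \<open>x \<in> B\<close> \<open>B \<subseteq> V\<close> by auto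
  next
    fix x assume x: "x \<in> V - B"
    have "(\<lambda>n. \<Sum>y\<in>V. p x y * ?u n y) \<longlonglongrightarrow> (\<Sum>y\<in>V. p x y * u y)"
      by (intro tendsto_intros lim)
    then have "(\<lambda>n. ?u (Suc n) x) \<longlonglongrightarrow> (\<Sum>y\<in>V. p x y * u y)"
      using x by (simp add: uS)
    moreover have "(\<lambda>n. ?u (Suc n) x) \<longlonglongrightarrow> u x"
      using x lim by (intro LIMSEQ_Suc) auto
    ultimately show "u x = (\<Sum>y\<in>V. p x y * u y)" using LIMSEQ_unique by blast
  qed
qed

definition dirichlet_solution :: "'v set \<Rightarrow> ('v \<Rightarrow> real) \<Rightarrow> 'v \<Rightarrow> real" where
  "dirichlet_solution B g =
     (SOME u. (\<forall>x\<in>B. u x = g x) \<and> (\<forall>x\<in>V - B. u x = (\<Sum>y\<in>V. p x y * u y)))"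

lemma dirichlet_solution:
  assumes "B \<subseteq> V" and "\<And>x. x \<in> B \<Longrightarrow> g x \<ge> 0"
  shows "x \<in> B \<Longrightarrow> dirichlet_solution B g x = g x"
    and "x \<in> V - B \<Longrightarrow>
      dirichlet_solution B g x = (\<Sum>y\<in>V. p x y * dirichlet_solution B g y)"
  using someI_ex[OF dirichlet_problem_solvable[where g = g, OF assms]]
  unfolding dirichlet_solution_def[symmetric] by blast+

section \<open>Costs at the last visited vertex, and Matthews' method\<close>

text \<open>A walk that enters \<open>S\<close> at \<open>x\<close> still has to visit
  \<open>S - {x}\<close>, which yields the boundary data. The counter stands for
  \<open>card S\<close> and makes the recursion primitive.\<close>

primrec last_cost_aux :: "('v \<Rightarrow> real) \<Rightarrow> nat \<Rightarrow> 'v set \<Rightarrow> 'v \<Rightarrow> real" where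
  "last_cost_aux c 0 S = c"
| "last_cost_aux c (Suc n) S = dirichlet_solution S (\<lambda>x. last_cost_aux c n (S - {x}) x)"

text \<open>The expectation of \<open>c\<close> at the vertex of \<open>S\<close> that is visited last, for the walk from \<open>x\<close>;
  for empty \<open>S\<close> this is \<open>c x\<close>.\<close>
definition last_cost :: "('v \<Rightarrow> real) \<Rightarrow> 'v set \<Rightarrow> 'v \<Rightarrow> real" where
  "last_cost c S = last_cost_aux c (card S) S"

text \<open>\<open>dirichlet_solution\<close> is characterized for nonnegative boundary data, so
  nonnegativity has to be carried through the recursion; the minimum principle does this.\<close>

lemma last_cost_aux_nonneg:
  assumes "\<And>x. x \<in> V \<Longrightarrow> c x \<ge> 0" "S \<subseteq> V" "card S = n" "x \<in> V"
  shows "last_cost_aux c n S x \<ge> 0"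
  using assms(2-)
proof (induction n arbitrary: S x)
  case 0
  then show ?case using assms(1) by simp
next
  case (Suc n)
  have *: "last_cost_aux c n (S - {x}) x \<ge> 0" if "x \<in> S" for x
    using Suc.IH[of "S - {x}" x] Suc.prems that by auto
  note sol = dirichlet_solution[OF \<open>S \<subseteq> V\<close>, of "\<lambda>x. last_cost_aux c n (S - {x}) x", OF *]
  have "S \<noteq> {}" using Suc.prems by auto
  show ?case
    using minimum_principle[OF \<open>S \<subseteq> V\<close> \<open>S \<noteq> {}\<close>, of "last_cost_aux c (Suc n) S" 0 x]
      sol * \<open>x \<in> V\<close> by simp
qed

lemma last_cost_empty [simp]: "last_cost c {} = c"
  by (simp add: last_cost_def)

text \<open>This is the recursion of a cover time without the running cost, so adding
  \<open>last_cost\<close> to \<open>cover_time\<close> preserves the form of the recursion.\<close>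

lemma last_cost_step:
  assumes c: "\<And>x. x \<in> V \<Longrightarrow> c x \<ge> 0" and S: "S \<subseteq> V"
  shows "x \<in> S \<Longrightarrow> last_cost c S x = last_cost c (S - {x}) x"
    and "S \<noteq> {} \<Longrightarrow> x \<in> V - S \<Longrightarrow> last_cost c S x = (\<Sum>y\<in>V. p x y * last_cost c S y)"
proof -
  have finS: "finite S" using S fin finite_subset by blast
  have "last_cost_aux c n (S - {x}) x \<ge> 0" if "x \<in> S" "card S = Suc n" for x n
    using that S by (intro last_cost_aux_nonneg c) auto
  note sol = dirichlet_solution[OF S, where g = "\<lambda>x. last_cost_aux c n (S - {x}) x" for n, OF this]
  show "last_cost c S x = last_cost c (S - {x}) x" if "x \<in> S"
  proof -
    have "card S \<noteq> 0" using that finS by auto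
    then obtain n where n: "card S = Suc n" using not0_implies_Suc by blast
    then show ?thesis using sol(1)[of n x] that by (simp add: last_cost_def)
  qed
  show "last_cost c S x = (\<Sum>y\<in>V. p x y * last_cost c S y)" if "S \<noteq> {}" "x \<in> V - S"
  proof -
    have "card S \<noteq> 0" using that finS by auto
    then obtain n where n: "card S = Suc n" using not0_implies_Suc by blast
    then show ?thesis using sol(2)[of n x] that by (simp add: last_cost_def)
  qed
qed

text \<open>The last cost is an average of values of \<open>c\<close> on \<open>S\<close>. Formally,
  the maximum principle reduces to starts in \<open>S\<close>, where the induction on
  \<open>card S\<close> applies.\<close>

lemma last_cost_le:
  assumes c: "\<And>x. x \<in> V \<Longrightarrow> c x \<ge> 0"
    and "S \<subseteq> V" "S \<noteq> {}" "\<And>x. x \<in> S \<Longrightarrow> c x \<le> K" "x \<in> V"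
  shows "last_cost c S x \<le> K"
  using assms(2-)
proof (induction "card S" arbitrary: S x rule: less_induct)
  case less
  show ?case
  proof (rule maximum_principle[OF \<open>S \<subseteq> V\<close> \<open>S \<noteq> {}\<close> _ _ \<open>x \<in> V\<close>])
    show "last_cost c S z \<le> (\<Sum>y\<in>V. p z y * last_cost c S y)" if "z \<in> V - S" for z
      using last_cost_step(2)[where c = c, OF c] less.prems that by simp
    show "last_cost c S z \<le> K" if z: "z \<in> S" for z
    proof (cases "S - {z} = {}")
      case True
      then show ?thesis
        using last_cost_step(1)[where c = c, OF c \<open>S \<subseteq> V\<close> z] less.prems(3)[OF z]
        by (simp only: last_cost_empty)
    next
      case False
      have "card (S - {z}) < card S"
        using z less.prems(1) fin by (meson card_Diff1_less finite_subset)
      then have "last_cost c (S - {z}) z \<le> K"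
        using less.hyps[of "S - {z}" z] False less.prems z by auto
      then show ?thesis using last_cost_step(1)[where c = c, OF c \<open>S \<subseteq> V\<close> z] by simp
    qed
  qed
qed

text \<open>The recursion satisfied by the expected total cost when every step before \<open>S\<close> is covered
  costs \<open>k\<close> and a further cost is charged at the vertex of \<open>S\<close> visited last.\<close>
definition cover_functional :: "real \<Rightarrow> ('v set \<Rightarrow> 'v \<Rightarrow> real) \<Rightarrow> bool" where
  "cover_functional k G \<longleftrightarrow> (\<forall>S\<subseteq>V. (\<forall>x\<in>S. G S x = G (S - {x}) x) \<and>
     (S \<noteq> {} \<longrightarrow> (\<forall>x\<in>V - S. G S x = k + (\<Sum>y\<in>V. p x y * G S y))))"

lemma cover_functional_start:
  "cover_functional k G \<Longrightarrow> S \<subseteq> V \<Longrightarrow> x \<in> S \<Longrightarrow> G S x = G (S - {x}) x"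
  unfolding cover_functional_def by blast

lemma cover_functional_outside:
  "cover_functional k G \<Longrightarrow> S \<subseteq> V \<Longrightarrow> S \<noteq> {} \<Longrightarrow> x \<in> V - S \<Longrightarrow>
    G S x = k + (\<Sum>y\<in>V. p x y * G S y)"
  unfolding cover_functional_def by blast

lemma cover_functional_cover_time: "cover_functional 1 cover_time"
  unfolding cover_functional_def using cover_time_start cover_time_outside by blast

text \<open>As a function of \<open>x\<close> the sum is harmonic off \<open>S\<close>, since the running costs cancel, and for
  \<open>x\<close> in \<open>S\<close> it equals the same sum for \<open>S - {x}\<close>. The maximum principle reduces to two-point sets.\<close>
lemma sum_increments_le:
  assumes G: "cover_functional k G"
    and "S \<subseteq> V" "card S \<ge> 2"
    and "\<And>x a. x \<in> S \<Longrightarrow> a \<in> S \<Longrightarrow> x \<noteq> a \<Longrightarrow> G {a} x - G {} x \<le> b"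
    and "x \<in> V"
  shows "(\<Sum>a\<in>S. G S x - G (S - {a}) x) \<le> b"
  using assms(2-)
proof (induction "card S" arbitrary: S x rule: less_induct)
  case less
  have finS: "finite S" using less.prems(1) fin finite_subset by blast
  have "S \<noteq> {}" using less.prems(2) by auto
  show ?case
  proof (rule maximum_principle[OF \<open>S \<subseteq> V\<close> \<open>S \<noteq> {}\<close> _ _ \<open>x \<in> V\<close>])
    fix z assume z: "z \<in> V - S"
    have "G S z - G (S - {a}) z = (\<Sum>y\<in>V. p z y * (G S y - G (S - {a}) y))" if "a \<in> S" for a
    proof -
      \<comment> \<open>The cancellation of \<open>k\<close> needs the recursion for
        \<open>S - {a}\<close> as well, which is available because this set is nonempty.\<close>
      have "card (S - {a}) \<ge> 1" using less.prems(2) that finS by simp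
      then have "S - {a} \<noteq> {}" by (metis card.empty not_one_le_zero)
      then show ?thesis
        using cover_functional_outside[OF G, of S z] cover_functional_outside[OF G, of "S - {a}" z]
          z less.prems(1) \<open>S \<noteq> {}\<close>
          subset_trans[OF Diff_subset, of S V "{a}"]
        by (simp add: right_diff_distrib sum_subtractf)
    qed
    then have "(\<Sum>a\<in>S. G S z - G (S - {a}) z)
        = (\<Sum>a\<in>S. \<Sum>y\<in>V. p z y * (G S y - G (S - {a}) y))" by simp
    also have "\<dots> = (\<Sum>y\<in>V. p z y * (\<Sum>a\<in>S. G S y - G (S - {a}) y))"
      by (subst sum.swap) (simp add: sum_distrib_left)
    finally show "(\<Sum>a\<in>S. G S z - G (S - {a}) z)
        \<le> (\<Sum>y\<in>V. p z y * (\<Sum>a\<in>S. G S y - G (S - {a}) y))" by simp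
  next
    fix z assume z: "z \<in> S"
    have start: "G T z = G (T - {z}) z" if "T \<subseteq> S" for T
      using cover_functional_start[OF G, of T z] that less.prems(1)
      by (cases "z \<in> T") (auto simp: Diff_triv)
    \<comment> \<open>The summand for \<open>a = z\<close> vanishes: a start at \<open>z\<close>
      counts as a visit to \<open>z\<close>.\<close>
    have "(\<Sum>a\<in>S. G S z - G (S - {a}) z) = (\<Sum>a\<in>S - {z}. G S z - G (S - {a}) z)"
      using start[of S] by (subst sum.remove[OF finS z]) simp
    also have "\<dots> = (\<Sum>a\<in>S - {z}. G (S - {z}) z - G (S - {z} - {a}) z)"
    proof (intro sum.cong refl)
      fix a assume "a \<in> S - {z}"
      have "S - {a} - {z} = S - {z} - {a}" by auto
      then show "G S z - G (S - {a}) z = G (S - {z}) z - G (S - {z} - {a}) z"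
        using start[of S] start[of "S - {a}"] by auto
    qed
    also have "\<dots> \<le> b"
    proof (cases "card S = 2")
      case True
      then obtain a where "S - {z} = {a}"
        using z finS by (metis card_1_singletonE card_Diff_singleton diff_add_inverse one_add_one)
      then show ?thesis using less.prems(3)[OF z, of a] z by auto
    next
      case False
      show ?thesis
      proof (intro less.hyps)
        show "card (S - {z}) < card S" by (rule card_Diff1_less[OF finS z])
        show "2 \<le> card (S - {z})" using False less.prems(2) z finS by simp
      qed (use less.prems z in auto)
    qed
    finally show "(\<Sum>a\<in>S. G S z - G (S - {a}) z) \<le> b" .
  qed
qed

text \<open>Averaging over the removed vertex: the increments sum to at most \<open>b\<close>, so
  passing from \<open>n - 1\<close> to \<open>n\<close> vertices raises the bound by
  \<open>b / n\<close>, and these terms add up to the harmonic number. No sign of \<open>b\<close>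
  or \<open>k\<close> is fixed, so lower bounds follow by applying this to a negated
  functional.\<close>

lemma matthews_bound:
  assumes G: "cover_functional k G"
    and "S \<subseteq> V" "S \<noteq> {}"
    and "\<And>x a. x \<in> S \<Longrightarrow> a \<in> S \<Longrightarrow> x \<noteq> a \<Longrightarrow> G {a} x - G {} x \<le> b"
    and "x \<in> V" and "\<And>a. a \<in> S \<Longrightarrow> G {a} x \<le> b0"
  shows "G S x \<le> b0 + b * (harm (card S) - 1)"
  using assms(2-4,6)
proof (induction "card S" arbitrary: S rule: less_induct)
  case less
  have finS: "finite S" using less.prems(1) fin finite_subset by blast
  have "card S > 0" using less.prems(2) finS by auto
  show ?case
  proof (cases "card S = 1")
    case True
    then obtain a where "S = {a}" by (rule card_1_singletonE)
    then show ?thesis using less.prems(4) by (simp add: harm_def)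
  next
    case False
    then have n: "card S \<ge> 2" using \<open>card S > 0\<close> by simp
    then obtain m where m: "card S = Suc m" "m > 0" by (cases "card S") auto
    have IH: "G (S - {a}) x \<le> b0 + b * (harm m - 1)" if "a \<in> S" for a
    proof -
      have "card (S - {a}) = m" using m that by simp
      moreover from this have "S - {a} \<noteq> {}" using m by (metis card.empty less_irrefl)
      ultimately show ?thesis using less.hyps[of "S - {a}"] less.prems m by auto
    qed
    have "real (card S) * G S x = (\<Sum>a\<in>S. G S x - G (S - {a}) x) + (\<Sum>a\<in>S. G (S - {a}) x)"
      by (simp add: sum_subtractf)
    also have "\<dots> \<le> b + (\<Sum>a\<in>S. b0 + b * (harm m - 1))"
      using less.prems n \<open>x \<in> V\<close> by (intro add_mono sum_mono IH sum_increments_le[OF G]) auto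
    also have "\<dots> = real (card S) * (b0 + b * (harm (card S) - 1))"
      by (simp add: m harm_Suc field_simps)
    finally show ?thesis using \<open>card S > 0\<close> by simp
  qed
qed

section \<open>Hitting times, the graph Laplacian and effective resistance\<close>

abbreviation hit :: "'v \<Rightarrow> 'v \<Rightarrow> real" where
  "hit x y \<equiv> cover_time {y} x"

lemma hit_self [simp]: "hit y y = 0"
  by (subst cover_time_start) simp

lemma hit_outside:
  "x \<in> V \<Longrightarrow> y \<in> V \<Longrightarrow> x \<noteq> y \<Longrightarrow> hit x y = 1 + (\<Sum>z\<in>V. p x z * hit z y)"
  by (rule cover_time_outside) auto

lemma hit_ge_1: "x \<in> V \<Longrightarrow> y \<in> V \<Longrightarrow> x \<noteq> y \<Longrightarrow> hit x y \<ge> 1"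
  using hit_outside[of x y] by (simp add: sum_nonneg p_nonneg cover_time_nonneg)

definition laplacian :: "('v \<Rightarrow> real) \<Rightarrow> 'v \<Rightarrow> real" where
  "laplacian f x = (\<Sum>z\<in>V. mu x z * (f x - f z))"

text \<open>Summation by parts: \<open>f x - f y\<close> is split, and symmetry of \<open>mu\<close>
  turns the second half into the first, whence the factor 2.\<close>

lemma green:
  "(\<Sum>x\<in>V. \<Sum>y\<in>V. mu x y * ((f x - f y) * (g x - g y))) = 2 * (\<Sum>x\<in>V. f x * laplacian g x)"
proof -
  have "(\<Sum>x\<in>V. \<Sum>y\<in>V. mu x y * ((f x - f y) * (g x - g y)))
      = (\<Sum>x\<in>V. \<Sum>y\<in>V. f x * (mu x y * (g x - g y)))
        + (\<Sum>x\<in>V. \<Sum>y\<in>V. f y * (mu x y * (g y - g x)))"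
    by (simp add: sum.distrib[symmetric] algebra_simps)
  also have "(\<Sum>x\<in>V. \<Sum>y\<in>V. f y * (mu x y * (g y - g x)))
      = (\<Sum>x\<in>V. \<Sum>y\<in>V. f x * (mu x y * (g x - g y)))"
    by (subst sum.swap) (simp add: mu_sym)
  finally show ?thesis by (simp add: laplacian_def sum_distrib_left)
qed

lemma laplacian_self_adjoint:
  "(\<Sum>x\<in>V. f x * laplacian g x) = (\<Sum>x\<in>V. g x * laplacian f x)"
  using green[of f g] green[of g f] by (simp add: mult.commute)

lemma energy_eq: "energy V mu f = (\<Sum>x\<in>V. f x * laplacian f x)"
  using green[of f f] by (simp add: energy_def power2_eq_square)

lemma energy_nonneg: "energy V mu f \<ge> 0"
  by (simp add: energy_def sum_nonneg mu_nonneg)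

lemma laplacian_diff: "laplacian (\<lambda>x. f x - g x) x = laplacian f x - laplacian g x"
  by (simp add: laplacian_def algebra_simps sum_subtractf sum.distrib)

lemma laplacian_affine: "laplacian (\<lambda>x. k * f x + c) x = k * laplacian f x"
  by (simp add: laplacian_def sum_distrib_left algebra_simps)

lemma sum_laplacian: "(\<Sum>x\<in>V. laplacian f x) = 0"
  using green[of "\<lambda>_. 1" f] by simp

text \<open>Off \<open>y\<close> this is the first-step equation multiplied by \<open>deg x\<close>.
  The value at \<open>y\<close> is then forced, because a Laplacian sums to 0 over
  \<open>V\<close>.\<close>

lemma laplacian_hit:
  assumes "x \<in> V" "y \<in> V"
  shows "laplacian (\<lambda>z. hit z y) x = deg x - (if x = y then vol else 0)"
proof -
  have off: "laplacian (\<lambda>z. hit z y) x = deg x" if "x \<in> V" "x \<noteq> y" for x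
  proof -
    have "laplacian (\<lambda>z. hit z y) x = deg x * (hit x y - (\<Sum>z\<in>V. p x z * hit z y))"
      using that deg_times_p[OF that(1)]
      by (simp add: laplacian_def right_diff_distrib sum_subtractf sum_distrib_left
          sum_distrib_right[symmetric] deg_def[symmetric] mult.assoc[symmetric])
    then show ?thesis using hit_outside[OF that(1) \<open>y \<in> V\<close> that(2)] by simp
  qed
  have "(\<Sum>x\<in>V - {y}. laplacian (\<lambda>z. hit z y) x) = (\<Sum>x\<in>V - {y}. deg x)"
    by (intro sum.cong) (auto simp: off)
  then have "laplacian (\<lambda>z. hit z y) y = deg y - vol"
    using sum_laplacian[of "\<lambda>z. hit z y"] unfolding vol_eq
    by (simp add: sum.remove[OF fin \<open>y \<in> V\<close>])
  then show ?thesis using off assms by auto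
qed

text \<open>The expected hitting time of \<open>y\<close> from the stationary distribution
  \<open>deg / vol\<close>.\<close>

definition stationary_hit :: "'v \<Rightarrow> real" where
  "stationary_hit y = (\<Sum>x\<in>V. deg x * hit x y) / vol"

text \<open>Pairing the hitting time of \<open>a\<close> with the Laplacian of the hitting time of
  \<open>b\<close> gives \<open>vol * (stationary_hit a - hit b a)\<close>. The Laplacian is
  self-adjoint, so this is symmetric in \<open>a\<close> and \<open>b\<close>.\<close>

lemma hit_diff:
  assumes "x \<in> V" "y \<in> V"
  shows "hit x y - hit y x = stationary_hit y - stationary_hit x"
proof -
  have *: "(\<Sum>z\<in>V. hit z a * laplacian (\<lambda>w. hit w b) z) = vol * (stationary_hit a - hit b a)"
    if "a \<in> V" "b \<in> V" for a b
  proof -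
    have "(\<Sum>z\<in>V. hit z a * laplacian (\<lambda>w. hit w b) z)
        = (\<Sum>z\<in>V. deg z * hit z a - (if z = b then vol * hit z a else 0))"
      by (intro sum.cong refl) (simp add: laplacian_hit that algebra_simps)
    also have "\<dots> = vol * (stationary_hit a - hit b a)"
      using vol_pos that fin by (simp add: sum_subtractf stationary_hit_def right_diff_distrib)
    finally show ?thesis .
  qed
  have "vol * (stationary_hit x - hit y x) = vol * (stationary_hit y - hit x y)"
    using laplacian_self_adjoint[of "\<lambda>z. hit z x" "\<lambda>z. hit z y"] * assms by simp
  then show ?thesis using vol_pos by simp
qed

text \<open>The difference of the hitting times of \<open>y\<close> and \<open>x\<close> is harmonic
  off these two vertices. Normalized, it is the equilibrium potential, which minimizes the energy,
  and its energy is \<open>vol\<close> divided by the commute time.\<close>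

lemma commute_time_identity:
  assumes "x \<in> V" "y \<in> V" "x \<noteq> y"
  shows "hit x y + hit y x = vol * R_eff V mu x y"
proof -
  define C where "C = hit x y + hit y x"
  have "C > 0" using hit_ge_1[of x y] hit_ge_1[of y x] assms by (simp add: C_def)
  \<comment> \<open>Scaling by \<open>1 / C\<close> and the added constant produce the boundary
    values 1 at \<open>x\<close> and 0 at \<open>y\<close>.\<close>
  define f where "f z = 1 / C * (hit z y - hit z x) + hit y x / C" for z
  have f: "f x = 1" "f y = 0"
    using \<open>C > 0\<close> by (simp_all add: f_def C_def add_divide_distrib[symmetric])
  have lap: "laplacian f z = vol / C * ((if z = x then 1 else 0) - (if z = y then 1 else 0))"
    if "z \<in> V" for z
    unfolding f_def laplacian_affine using that assms by (simp add: laplacian_diff laplacian_hit)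
  have inner: "(\<Sum>z\<in>V. g z * laplacian f z) = vol / C * (g x - g y)" for g
  proof -
    have "(\<Sum>z\<in>V. g z * laplacian f z)
        = (\<Sum>z\<in>V. (if z = x then vol / C * g z else 0) - (if z = y then vol / C * g z else 0))"
      by (intro sum.cong refl) (simp add: lap)
    then show ?thesis using assms fin by (simp add: sum_subtractf right_diff_distrib)
  qed
  have Ef: "energy V mu f = vol / C" by (simp add: energy_eq inner f)
  have min: "vol / C \<le> energy V mu g" if "g x = 1" "g y = 0" for g
  proof -
    \<comment> \<open>Both cross terms equal \<open>vol / C\<close>, since \<open>g\<close> and
      \<open>f\<close> agree at \<open>x\<close> and \<open>y\<close>, and so does the energy of
      \<open>f\<close>.\<close>
    have "0 \<le> energy V mu (\<lambda>z. g z - f z)" by (rule energy_nonneg)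
    also have "\<dots> = (\<Sum>z\<in>V. g z * laplacian g z) - (\<Sum>z\<in>V. g z * laplacian f z)
        - (\<Sum>z\<in>V. f z * laplacian g z) + (\<Sum>z\<in>V. f z * laplacian f z)"
      by (simp add: energy_eq laplacian_diff algebra_simps sum_subtractf sum.distrib)
    also have "\<dots> = energy V mu g - vol / C"
      using laplacian_self_adjoint[of f g] by (simp add: energy_eq inner f that)
    finally show ?thesis by simp
  qed
  have "Inf {energy V mu f | f. f x = 1 \<and> f y = 0} = vol / C"
  proof (rule cInf_eq_minimum)
    show "vol / C \<in> {energy V mu f | f. f x = 1 \<and> f y = 0}"
      unfolding Ef[symmetric] using f by blast
  qed (use min in auto)
  then show ?thesis using \<open>x \<noteq> y\<close> vol_pos by (simp add: R_eff_def C_def)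
qed

text \<open>With \<open>\<pi>(y)\<close> the stationary mean hitting time of \<open>y\<close>, \<open>hit x y\<close> is half the commute time plus
  \<open>(\<pi>(y) - \<pi>(x)) / 2\<close>. Charging the terminal cost \<open>c = - \<pi> / 2\<close> (shifted to be nonnegative) makes
  the second part telescope along the order in which \<open>A\<close> is visited, and starting where \<open>c\<close> is
  maximal the net charge is nonpositive.\<close>
lemma cover_time_ge_commute:
  assumes "A \<subseteq> V" "A \<noteq> {}"
    and kappa: "\<And>x y. x \<in> A \<Longrightarrow> y \<in> A \<Longrightarrow> x \<noteq> y \<Longrightarrow> hit x y + hit y x \<ge> kappa"
  obtains x where "x \<in> A" "cover_time A x \<ge> kappa / 2 * (harm (card A) - 1)"
proof -
  define K where "K = Max (stationary_hit ` V)"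
  define c where "c x = (K - stationary_hit x) / 2" for x
  have c_nonneg: "c x \<ge> 0" if "x \<in> V" for x
    using that fin by (simp add: c_def K_def)
  have hit_c: "hit x y + c y - c x = (hit x y + hit y x) / 2" if "x \<in> V" "y \<in> V" for x y
    using hit_diff[OF that] by (simp add: c_def field_simps)
  have finA: "finite A" using assms fin finite_subset by blast
  have "Max (c ` A) \<in> c ` A" using finA \<open>A \<noteq> {}\<close> by (intro Max_in) auto
  then obtain x where "x \<in> A" "c x = Max (c ` A)" by auto
  then have x: "x \<in> A" "\<And>y. y \<in> A \<Longrightarrow> c y \<le> c x" using finA by simp_all
  have "x \<in> V" using x assms by auto
  \<comment> \<open>The sign turns the lower bound sought into an upper bound, with running cost
    -1.\<close>
  define G where "G S z = - (cover_time S z + last_cost c S z)" for S z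
  have "cover_functional (-1) G"
    unfolding cover_functional_def
  proof (intro allI impI conjI ballI)
    fix S z assume "S \<subseteq> V" "z \<in> S"
    then show "G S z = G (S - {z}) z"
      using last_cost_step(1)[where c = c, OF c_nonneg, of S z] cover_time_start[of S z]
      by (simp add: G_def)
  next
    fix S z assume *: "S \<subseteq> V" "S \<noteq> {}" "z \<in> V - S"
    show "G S z = - 1 + (\<Sum>y\<in>V. p z y * G S y)"
      using last_cost_step(2)[where c = c, OF c_nonneg *] cover_time_outside[OF *]
      by (simp add: G_def right_diff_distrib distrib_left sum_subtractf sum.distrib sum_negf)
  qed
  \<comment> \<open>For a single target the last vertex is certain: the terminal cost is harmonic
    off \<open>a\<close>, hence the constant \<open>c a\<close>.\<close>
  moreover have G1: "G {a} z = - (hit z a + c a)" if "a \<in> V" "z \<in> V" for a z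
  proof -
    have a: "last_cost c {a} a = c a"
      using last_cost_step(1)[where c = c, OF c_nonneg, of "{a}" a] that by simp
    have harm: "last_cost c {a} w = (\<Sum>y\<in>V. p w y * last_cost c {a} y)" if "w \<in> V - {a}" for w
      using last_cost_step(2)[where c = c, OF c_nonneg, of "{a}" w] that \<open>a \<in> V\<close> by simp
    have "last_cost c {a} z \<le> c a"
      using maximum_principle[of "{a}" "last_cost c {a}" "c a" z] a harm that by auto
    moreover have "last_cost c {a} z \<ge> c a"
      using minimum_principle[of "{a}" "last_cost c {a}" "c a" z] a harm that by auto
    ultimately show ?thesis by (simp add: G_def)
  qed
  have "G {a} z - G {} z \<le> - (kappa / 2)" if "z \<in> A" "a \<in> A" "z \<noteq> a" for z a
  proof -
    have "G {a} z - G {} z = - (hit z a + c a - c z)"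
      using that assms by (subst G1) (auto simp: G_def)
    also have "\<dots> \<le> - (kappa / 2)"
      using hit_c[of z a] kappa[OF that] that assms(1) by (simp add: subset_iff)
    finally show ?thesis .
  qed
  moreover have "G {a} x \<le> - c x" if "a \<in> A" for a
  proof -
    have "hit x a \<ge> 0" "hit a x \<ge> 0" using that assms x by (auto intro!: cover_time_nonneg)
    moreover have "a \<in> V" using that assms by auto
    ultimately show ?thesis
      using hit_c[OF \<open>x \<in> V\<close> \<open>a \<in> V\<close>] G1[OF \<open>a \<in> V\<close> \<open>x \<in> V\<close>] by simp
  qed
  ultimately have "G A x \<le> - c x + - (kappa / 2) * (harm (card A) - 1)"
    using \<open>x \<in> V\<close> assms by (intro matthews_bound[where G = G and k = "-1"]) auto
  \<comment> \<open>By the choice of \<open>x\<close> the expected terminal cost is at most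
    \<open>c x\<close>, which offsets the term \<open>- c x\<close> in the bound for
    \<open>G A x\<close>.\<close>
  moreover have "last_cost c A x \<le> c x"
    using x \<open>x \<in> V\<close> assms by (intro last_cost_le c_nonneg) auto
  ultimately have "cover_time A x \<ge> kappa / 2 * (harm (card A) - 1)"
    by (simp add: G_def)
  then show ?thesis using that x by blast
qed

section \<open>Bounds on the maximal hitting and cover times\<close>

lemma pairs_image: "{f x y | x y. x \<in> V \<and> y \<in> V} = (\<lambda>(x, y). f x y) ` (V \<times> V)"
  by auto

lemma exp_hit_le_t_hit: "x \<in> V \<Longrightarrow> y \<in> V \<Longrightarrow> hit x y \<le> t_hit V mu"
  unfolding t_hit_def exp_hit_eq pairs_image using fin by (intro Max_ge) auto

lemma t_hit_pos: "t_hit V mu > 0"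
proof -
  obtain x where "x \<in> V" using V_nonempty by auto
  moreover obtain y where "y \<in> V" "y \<noteq> x" by (rule other_vertex)
  ultimately show ?thesis using exp_hit_le_t_hit[of x y] hit_ge_1[of x y] by force
qed

lemma R_eff_le_diam: "x \<in> V \<Longrightarrow> y \<in> V \<Longrightarrow> R_eff V mu x y \<le> diam_R V mu"
  unfolding diam_R_def pairs_image using fin by (intro Max_ge) auto

text \<open>A hitting time is at most the corresponding commute time, which is \<open>vol\<close>
  times a resistance.\<close>

lemma t_hit_le: "t_hit V mu \<le> vol * diam_R V mu"
proof -
  have "hit x y \<le> vol * diam_R V mu" if "x \<in> V" "y \<in> V" for x y
  proof (cases "x = y")
    case True
    then show ?thesis using R_eff_le_diam[OF that] vol_pos by (simp add: R_eff_def)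
  next
    case False
    then have "hit x y \<le> vol * R_eff V mu x y"
      using commute_time_identity[OF that] hit_ge_1[of y x] that by simp
    also have "\<dots> \<le> vol * diam_R V mu"
      using R_eff_le_diam[OF that] vol_pos by simp
    finally show ?thesis .
  qed
  then show ?thesis
    unfolding t_hit_def exp_hit_eq pairs_image using fin V_nonempty by (subst Max_le_iff) auto
qed

text \<open>Matthews' bound with running cost 1, where \<open>t_hit V mu\<close> serves both as
  \<open>b\<close> and as \<open>b0\<close>.\<close>

lemma t_cov_le: "t_cov V mu \<le> t_hit V mu * harm (card V)"
proof -
  have "cover_time V x \<le> t_hit V mu + t_hit V mu * (harm (card V) - 1)" if "x \<in> V" for x
    using that V_nonempty exp_hit_le_t_hit
    by (intro matthews_bound[OF cover_functional_cover_time]) auto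
  then have "cover_time V x \<le> t_hit V mu * harm (card V)" if "x \<in> V" for x
    using that by (simp add: right_diff_distrib)
  then show ?thesis unfolding t_cov_def using fin V_nonempty by (simp add: exp_cov_eq)
qed

text \<open>The centers of a maximal packing have pairwise commute times of at least
  \<open>vol * r\<close>, and covering \<open>V\<close> includes covering them.\<close>

lemma t_cov_ge:
  assumes "r \<ge> 0"
  shows "t_cov V mu \<ge> vol * r / 2 * (harm (n_pac V mu r) - 1)"
proof -
  obtain A where A: "A \<subseteq> V" "A \<noteq> {}" "card A = n_pac V mu r"
    "\<And>x y. x \<in> A \<Longrightarrow> y \<in> A \<Longrightarrow> x \<noteq> y \<Longrightarrow> R_eff V mu x y > r"
    using packing[OF fin V_nonempty assms] by blast
  have "hit x y + hit y x \<ge> vol * r" if "x \<in> A" "y \<in> A" "x \<noteq> y" for x y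
  proof -
    have "vol * r \<le> vol * R_eff V mu x y" using A(4)[OF that] vol_pos by simp
    moreover have "x \<in> V" "y \<in> V" using A(1) that by auto
    ultimately show ?thesis using commute_time_identity[of x y] \<open>x \<noteq> y\<close> by simp
  qed
  then obtain x where x: "x \<in> A" "cover_time A x \<ge> vol * r / 2 * (harm (card A) - 1)"
    using cover_time_ge_commute[OF A(1,2), of "vol * r"] by (metis (no_types, lifting))
  note x(2)
  also have "cover_time A x \<le> cover_time V x"
    using x A by (intro cover_time_mono) auto
  also have "\<dots> \<le> t_cov V mu"
    unfolding t_cov_def exp_cov_eq using x A fin by (intro Max_ge) auto
  finally show ?thesis using A by simp
qed

end

text \<open>The difference of \<open>harm n\<close> and \<open>ln n\<close> decreases from its value
  1 at \<open>n = 1\<close>; the library sequence is shifted by one, hence the indices 0 and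
  \<open>n - 1\<close>.\<close>

lemma harm_le_ln: "n > 0 \<Longrightarrow> harm n \<le> 1 + ln (real n)"
  using decseqD[OF decseq_harm_diff_ln, of 0 "n - 1"] by (simp add: harm_def)

lemma (in network) t_cov_le_ln: "t_cov V mu \<le> t_hit V mu * (1 + ln (card V))"
proof -
  have "harm (card V) \<le> 1 + ln (real (card V))"
    using card_ge_2 by (intro harm_le_ln) simp
  then have "t_hit V mu * harm (card V) \<le> t_hit V mu * (1 + ln (card V))"
    using t_hit_pos by (intro mult_left_mono) auto
  then show ?thesis using t_cov_le by linarith
qed

text \<open>Graphs with one vertex lie outside the locale \<open>network\<close>, so the upper bound
  treats them separately: the start already covers everything.\<close>

lemma t_cov_singleton: "t_cov {a} mu = 0"
proof -
  have no_paths: "{xs \<in> walk_paths {a} x n. set xs \<noteq> {a}} = {}" for x n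
  proof -
    have "set xs = {a}" if "xs \<in> walk_paths {a} x n" for xs
    proof -
      have "set xs \<noteq> {}" "set xs \<subseteq> {a}" using that by (auto simp: walk_paths_def)
      then show ?thesis by (meson subset_singletonD)
    qed
    then show ?thesis by auto
  qed
  show ?thesis unfolding t_cov_def exp_cov_def cov_tail_def no_paths by simp
qed

section \<open>Estimates for a single graph with explicit constants\<close>

text \<open>The properties that hold for almost every outcome; unlike in \<open>network\<close>, a
  single vertex is allowed.\<close>

definition connected_network :: "'v set \<Rightarrow> ('v \<Rightarrow> 'v \<Rightarrow> real) \<Rightarrow> bool" where
  "connected_network V mu \<longleftrightarrow> finite V \<and> V \<noteq> {} \<and> graph_connected V mu \<and>
     (\<forall>x y. mu x y \<ge> 0 \<and> mu x y = mu y x)"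

lemma connected_network_imp_network:
  "connected_network V mu \<Longrightarrow> card V \<ge> 2 \<Longrightarrow> network V mu"
  by (simp add: connected_network_def network_def)

lemma t_cov_upper:
  assumes net: "connected_network V mu"
    and c: "c2 > 0" "r \<ge> 0" "ln v \<ge> 1"
    and card: "ln (card V) \<le> c1 * ln v" and diam: "diam_R V mu \<le> c2 * r" and "c1 > 0"
  shows "t_cov V mu / graph_volume V mu \<le> (c2 * (1 + c1)) * r * ln v"
proof (cases "card V \<ge> 2")
  case True
  interpret network V mu using net True by (rule connected_network_imp_network)
  have "t_cov V mu \<le> t_hit V mu * (1 + ln (card V))" by (rule t_cov_le_ln)
  \<comment> \<open>The summand 1 is absorbed by \<open>ln v \<ge> 1\<close>, which explains the
    factor \<open>1 + c1\<close>.\<close>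
  also have "\<dots> \<le> (vol * (c2 * r)) * (ln v + c1 * ln v)"
  proof (rule mult_mono)
    show "t_hit V mu \<le> vol * (c2 * r)"
      using t_hit_le diam vol_pos by (smt (verit) mult_left_mono)
    show "0 \<le> vol * (c2 * r)" using vol_pos c by simp
    show "0 \<le> 1 + ln (real (card V))" using card_ge_2 by simp
  qed (use c card in auto)
  finally show ?thesis using vol_pos by (simp add: field_simps)
next
  \<comment> \<open>With one vertex the cover time is 0, so the quotient is 0 even if the volume
    vanishes.\<close>
  case False
  have "card V \<noteq> 0" using net by (simp add: connected_network_def)
  with False have "card V = 1" by simp
  then obtain a where "V = {a}" by (rule card_1_singletonE)
  then show ?thesis using c \<open>c1 > 0\<close> by (simp add: t_cov_singleton)
qed

text \<open>A positive logarithm rules out packing number 1, and also 0 by the convention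
  \<open>ln 0 = 0\<close>, so there are at least two vertices.\<close>

lemma network_of_packing:
  assumes net: "connected_network V mu" and "r \<ge> 0" "ln (real (n_pac V mu r)) > 0"
  shows "network V mu"
proof (rule connected_network_imp_network[OF net])
  have "n_pac V mu r \<le> card V"
    using net \<open>r \<ge> 0\<close> by (intro n_pac_le_card) (auto simp: connected_network_def)
  moreover have "n_pac V mu r \<noteq> 0" "n_pac V mu r \<noteq> 1" using assms(3) by (auto intro!: gr0I)
  ultimately show "card V \<ge> 2" by linarith
qed

lemma t_cov_lower:
  assumes net: "connected_network V mu"
    and c: "c4 > 0" "r \<ge> 0" "c5 * ln v \<ge> 2"
    and pac: "ln (real (n_pac V mu (c4 * r))) \<ge> c5 * ln v"
  shows "t_cov V mu / graph_volume V mu \<ge> (c4 * c5 / 4) * r * ln v"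
proof -
  interpret network V mu
    using net c pac by (intro network_of_packing[of V mu "c4 * r"]) auto
  let ?n = "n_pac V mu (c4 * r)"
  have "?n > 0" using c pac by (intro gr0I) auto
  have "ln (real ?n) \<le> ln (real ?n + 1)" using \<open>?n > 0\<close> by simp
  also have "\<dots> \<le> harm ?n" by (rule ln_le_harm)
  \<comment> \<open>Half of \<open>c5 * ln v\<close> is at least 1 and pays for the subtracted 1.
    Together with the 1/2 in \<open>t_cov_ge\<close> this gives the constant
    \<open>c4 * c5 / 4\<close>.\<close>
  finally have "c5 * ln v / 2 \<le> harm ?n - 1" using c pac by linarith
  then have "vol * (c4 * r) / 2 * (c5 * ln v / 2) \<le> vol * (c4 * r) / 2 * (harm ?n - 1)"
    using c vol_pos by (intro mult_left_mono) auto
  also have "\<dots> \<le> t_cov V mu" using c by (intro t_cov_ge) simp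
  finally show ?thesis using vol_pos by (simp add: field_simps)
qed

text \<open>The threshold for \<open>l\<close> is the quotient of the constants in the upper bound
  for \<open>t_hit V mu * ln (card V)\<close> and the lower bound for \<open>t_cov V mu\<close>,
  both relative to \<open>vol * r * ln v\<close>. The packing forces
  \<open>ln (card V) \<ge> 2\<close>, so \<open>1 + ln (card V)\<close> is at most twice the
  logarithm; this gives the upper bound 2.\<close>

lemma cover_ratio_bounds:
  assumes net: "connected_network V mu"
    and c: "c1 > 0" "c2 > 0" "c4 > 0" "c5 > 0" "r \<ge> 0" "c5 * ln v \<ge> 2"
    and card: "ln (card V) \<le> c1 * ln v" and diam: "diam_R V mu \<le> c2 * r"
    and pac: "ln (real (n_pac V mu (c4 * r))) \<ge> c5 * ln v"
    and l: "l \<ge> 4 * c1 * c2 / (c4 * c5)"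
  shows "1 / l \<le> t_cov V mu / (t_hit V mu * ln (card V)) \<and>
    t_cov V mu / (t_hit V mu * ln (card V)) \<le> 2"
proof -
  interpret network V mu
    using net c pac by (intro network_of_packing[of V mu "c4 * r"]) auto
  let ?n = "n_pac V mu (c4 * r)"
  have "?n > 0" using c pac by (intro gr0I) auto
  have "?n \<le> card V" using c fin V_nonempty by (intro n_pac_le_card) auto
  then have "ln (real ?n) \<le> ln (real (card V))" using \<open>?n > 0\<close> by simp
  then have ln2: "ln (real (card V)) \<ge> 2" using pac c by linarith
  have pos: "t_hit V mu * ln (card V) > 0" using t_hit_pos ln2 by simp
  have "ln v > 0" using c by (smt (verit) mult_nonneg_nonpos)
  have "0 < 4 * c1 * c2 / (c4 * c5)" using c by simp
  then have "l > 0" using l by linarith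
  have "t_hit V mu * ln (card V) \<le> (vol * (c2 * r)) * (c1 * ln v)"
  proof (rule mult_mono)
    show "t_hit V mu \<le> vol * (c2 * r)"
      using t_hit_le diam vol_pos by (smt (verit) mult_left_mono)
  qed (use vol_pos c card ln2 in auto)
  also have "\<dots> = (4 * c1 * c2 / (c4 * c5)) * (vol * ((c4 * c5 / 4) * r * ln v))"
    using c by (simp add: field_simps)
  also have "\<dots> \<le> l * (vol * ((c4 * c5 / 4) * r * ln v))"
    using l vol_pos c \<open>ln v > 0\<close> by (intro mult_right_mono) auto
  also have "\<dots> \<le> l * t_cov V mu"
    using t_cov_lower[OF net c(3,5,6) pac] vol_pos \<open>l > 0\<close> by (simp add: field_simps)
  finally have lower: "t_hit V mu * ln (card V) \<le> l * t_cov V mu" .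
  have "t_hit V mu * (1 + ln (card V)) \<le> t_hit V mu * (2 * ln (card V))"
    using ln2 t_hit_pos by (intro mult_left_mono) auto
  then have "t_cov V mu \<le> 2 * (t_hit V mu * ln (card V))" using t_cov_le_ln by simp
  with lower show ?thesis using pos \<open>l > 0\<close> by (simp add: divide_simps mult.commute)
qed

section \<open>Inner probability and events of high probability\<close>

context prob_space
begin

lemma inner_prob_bdd: "bdd_above (prob ` {B \<in> events. B \<subseteq> A})"
  by (intro bdd_aboveI[of _ 1]) auto

lemma inner_prob_le_1: "inner_prob M A \<le> 1"
  unfolding inner_prob_def by (intro cSUP_least) auto

lemma prob_le_inner_prob: "B \<in> events \<Longrightarrow> B \<subseteq> A \<Longrightarrow> prob B \<le> inner_prob M A"
  unfolding inner_prob_def by (intro cSUP_upper inner_prob_bdd) auto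

lemma inner_prob_mono: "A \<subseteq> B \<Longrightarrow> inner_prob M A \<le> inner_prob M B"
  unfolding inner_prob_def by (intro cSUP_subset_mono inner_prob_bdd) auto

text \<open>For measurable subsets this is inclusion-exclusion with the union bounded by 1. The
  suprema over the two approximating families are taken one after the other.\<close>

lemma inner_prob_Int: "inner_prob M A + inner_prob M B - 1 \<le> inner_prob M (A \<inter> B)"
proof -
  have "prob C + prob D - 1 \<le> inner_prob M (A \<inter> B)"
    if "C \<in> events" "C \<subseteq> A" "D \<in> events" "D \<subseteq> B" for C D
  proof -
    have "prob C + prob D = prob (C \<union> D) + prob (C \<inter> D)"
      using that finite_measure_Union'[of C D] finite_measure_Diff'[of D C]
      by (simp add: Int_commute)
    moreover have "prob (C \<inter> D) \<le> inner_prob M (A \<inter> B)"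
      using that by (intro prob_le_inner_prob) auto
    moreover have "prob (C \<union> D) \<le> 1" by simp
    ultimately show ?thesis by linarith
  qed
  then have "inner_prob M A \<le> inner_prob M (A \<inter> B) + 1 - prob D"
    if "D \<in> events" "D \<subseteq> B" for D
    unfolding inner_prob_def[of M A] using that by (intro cSUP_least) (auto simp: algebra_simps)
  then have "inner_prob M B \<le> inner_prob M (A \<inter> B) + 1 - inner_prob M A"
    unfolding inner_prob_def[of M B] by (intro cSUP_least) (auto simp: algebra_simps)
  then show ?thesis by simp
qed

text \<open>An implication for large \<open>N\<close> suffices, because high probability is a limit;
  deterministic asymptotics of \<open>v\<close> enter in this way.\<close>

lemma whp_mono:
  assumes P: "whp M P"
    and imp: "\<forall>\<^sub>F N in sequentially. \<forall>\<omega>\<in>space M. P N \<omega> \<longrightarrow> Q N \<omega>"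
  shows "whp M Q"
  unfolding whp_def
proof (rule tendsto_sandwich)
  show "\<forall>\<^sub>F N in sequentially.
      inner_prob M {\<omega> \<in> space M. P N \<omega>} \<le> inner_prob M {\<omega> \<in> space M. Q N \<omega>}"
    using imp by eventually_elim (auto intro: inner_prob_mono)
  show "(\<lambda>N. inner_prob M {\<omega> \<in> space M. P N \<omega>}) \<longlonglongrightarrow> 1" using P by (simp add: whp_def)
qed (auto simp: inner_prob_le_1)

lemma whp_conj:
  assumes "whp M P" "whp M Q"
  shows "whp M (\<lambda>N \<omega>. P N \<omega> \<and> Q N \<omega>)"
  unfolding whp_def
proof (rule tendsto_sandwich)
  have "{\<omega> \<in> space M. P N \<omega>} \<inter> {\<omega> \<in> space M. Q N \<omega>} = {\<omega> \<in> space M. P N \<omega> \<and> Q N \<omega>}" for N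
    by auto
  then show "\<forall>\<^sub>F N in sequentially.
      inner_prob M {\<omega> \<in> space M. P N \<omega>} + inner_prob M {\<omega> \<in> space M. Q N \<omega>} - 1
        \<le> inner_prob M {\<omega> \<in> space M. P N \<omega> \<and> Q N \<omega>}"
    by (metis (mono_tags, lifting) always_eventually inner_prob_Int)
  have "(\<lambda>N. inner_prob M {\<omega> \<in> space M. P N \<omega>} + inner_prob M {\<omega> \<in> space M. Q N \<omega>} - 1)
      \<longlonglongrightarrow> 1 + 1 - 1"
    using assms unfolding whp_def by (intro tendsto_intros)
  then show "(\<lambda>N. inner_prob M {\<omega> \<in> space M. P N \<omega>} + inner_prob M {\<omega> \<in> space M. Q N \<omega>} - 1)
      \<longlonglongrightarrow> 1" by simp
qed (auto simp: inner_prob_le_1)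

text \<open>An almost sure property contains a measurable event of probability 1, so its inner
  probability is 1 even if the property itself is not measurable.\<close>

lemma whp_AE:
  assumes "\<And>N. AE \<omega> in M. P N \<omega>"
  shows "whp M P"
proof -
  have "inner_prob M {\<omega> \<in> space M. P N \<omega>} = 1" for N
  proof -
    obtain E where E: "E \<in> events" "prob E = 1" "E \<subseteq> {\<omega> \<in> space M. P N \<omega>}"
      using AE_E_prob[OF assms[of N]] .
    then show ?thesis
      using prob_le_inner_prob[OF E(1,3)] inner_prob_le_1 by (simp add: order_antisym)
  qed
  then show ?thesis by (simp add: whp_def)
qed

end

section \<open>The three asymptotic statements\<close>

theorem theorem1p2:
  fixes M :: "'w measure"
    and V :: "nat \<Rightarrow> 'w \<Rightarrow> 'v set"
    and mu :: "nat \<Rightarrow> 'w \<Rightarrow> 'v \<Rightarrow> 'v \<Rightarrow> real"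
  assumes "prob_space M"
    and "\<forall>N. \<forall>\<omega>\<in>space M. \<forall>x y. mu N \<omega> x y \<ge> 0 \<and> mu N \<omega> x y = mu N \<omega> y x"
    and "\<forall>N. AE \<omega> in M. finite (V N \<omega>) \<and> V N \<omega> \<noteq> {} \<and> graph_connected (V N \<omega>) (mu N \<omega>)"
  shows
   "(\<forall>(c1::real) (c2::real) (v::nat \<Rightarrow> real) (r::nat \<Rightarrow> real).
       c1 > 0 \<and> c2 > 0 \<and> (\<forall>N. v N \<ge> 0 \<and> r N \<ge> 0) \<and> filterlim v at_top sequentially \<and>
       whp M (\<lambda>N \<omega>. ln (card (V N \<omega>)) \<le> c1 * ln (v N) \<and> diam_R (V N \<omega>) (mu N \<omega>) \<le> c2 * r N)
       \<longrightarrow> (\<exists>c3>0. whp M (\<lambda>N \<omega>.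
              t_cov (V N \<omega>) (mu N \<omega>) / graph_volume (V N \<omega>) (mu N \<omega>) \<le> c3 * r N * ln (v N))))
    \<and>
    (\<forall>(c4::real) (c5::real) (v::nat \<Rightarrow> real) (r::nat \<Rightarrow> real).
       c4 > 0 \<and> c5 > 0 \<and> (\<forall>N. v N \<ge> 0 \<and> r N \<ge> 0) \<and> filterlim v at_top sequentially \<and>
       whp M (\<lambda>N \<omega>. ln (real (n_pac (V N \<omega>) (mu N \<omega>) (c4 * r N))) \<ge> c5 * ln (v N))
       \<longrightarrow> (\<exists>c6>0. whp M (\<lambda>N \<omega>.
              t_cov (V N \<omega>) (mu N \<omega>) / graph_volume (V N \<omega>) (mu N \<omega>) \<ge> c6 * r N * ln (v N))))
    \<and>
    (\<forall>(c1::real) (c2::real) (c4::real) (c5::real) (v::nat \<Rightarrow> real) (r::nat \<Rightarrow> real).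
       c1 > 0 \<and> c2 > 0 \<and> c4 > 0 \<and> c5 > 0 \<and> (\<forall>N. v N \<ge> 0 \<and> r N \<ge> 0) \<and>
       filterlim v at_top sequentially \<and>
       whp M (\<lambda>N \<omega>. ln (card (V N \<omega>)) \<le> c1 * ln (v N) \<and> diam_R (V N \<omega>) (mu N \<omega>) \<le> c2 * r N) \<and>
       whp M (\<lambda>N \<omega>. ln (real (n_pac (V N \<omega>) (mu N \<omega>) (c4 * r N))) \<ge> c5 * ln (v N))
       \<longrightarrow> type1 M V mu)"
proof -
  interpret prob_space M by fact
  let ?net = "\<lambda>N \<omega>. connected_network (V N \<omega>) (mu N \<omega>)"
  have net: "whp M ?net"
  proof (rule whp_AE)
    fix N
    have "AE \<omega> in M. finite (V N \<omega>) \<and> V N \<omega> \<noteq> {} \<and> graph_connected (V N \<omega>) (mu N \<omega>)"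
      using assms(3) by blast
    then show "AE \<omega> in M. ?net N \<omega>"
      using AE_space by eventually_elim (use assms(2) in \<open>auto simp: connected_network_def\<close>)
  qed
  have ln_ge: "\<forall>\<^sub>F N in sequentially. ln (v N) \<ge> K"
    if "filterlim v at_top sequentially" for v :: "nat \<Rightarrow> real" and K
    using filterlim_compose[OF ln_at_top that] by (simp add: filterlim_at_top)
  have mult_ln_ge: "\<forall>\<^sub>F N in sequentially. c * ln (v N) \<ge> K"
    if "filterlim v at_top sequentially" "c > 0" for v :: "nat \<Rightarrow> real" and c K
    using ln_ge[OF that(1), of "K / c"] \<open>c > 0\<close> by (simp add: field_simps)
  show ?thesis
  proof (intro conjI allI impI; elim conjE)
    fix c1 c2 :: real and v r :: "nat \<Rightarrow> real"
    assume c: "c1 > 0" "c2 > 0" and r: "\<forall>N. v N \<ge> 0 \<and> r N \<ge> 0"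
      and v: "filterlim v at_top sequentially"
      and H: "whp M (\<lambda>N \<omega>. ln (card (V N \<omega>)) \<le> c1 * ln (v N) \<and>
        diam_R (V N \<omega>) (mu N \<omega>) \<le> c2 * r N)"
    have "whp M (\<lambda>N \<omega>. t_cov (V N \<omega>) (mu N \<omega>) / graph_volume (V N \<omega>) (mu N \<omega>)
        \<le> (c2 * (1 + c1)) * r N * ln (v N))"
      by (rule whp_mono[OF whp_conj[OF net H]], use ln_ge[OF v, of 1] in eventually_elim)
        (use c r in \<open>auto intro!: t_cov_upper\<close>)
    moreover have "c2 * (1 + c1) > 0" using c by simp
    ultimately show "\<exists>c3>0. whp M (\<lambda>N \<omega>.
        t_cov (V N \<omega>) (mu N \<omega>) / graph_volume (V N \<omega>) (mu N \<omega>) \<le> c3 * r N * ln (v N))"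
      by blast
  next
    fix c4 c5 :: real and v r :: "nat \<Rightarrow> real"
    assume c: "c4 > 0" "c5 > 0" and r: "\<forall>N. v N \<ge> 0 \<and> r N \<ge> 0"
      and v: "filterlim v at_top sequentially"
      and H: "whp M (\<lambda>N \<omega>. ln (real (n_pac (V N \<omega>) (mu N \<omega>) (c4 * r N))) \<ge> c5 * ln (v N))"
    have "whp M (\<lambda>N \<omega>. t_cov (V N \<omega>) (mu N \<omega>) / graph_volume (V N \<omega>) (mu N \<omega>)
        \<ge> (c4 * c5 / 4) * r N * ln (v N))"
      by (rule whp_mono[OF whp_conj[OF net H]], use mult_ln_ge[OF v c(2), of 2] in eventually_elim)
        (use c r t_cov_lower in blast)
    moreover have "c4 * c5 / 4 > 0" using c by simp
    ultimately show "\<exists>c6>0. whp M (\<lambda>N \<omega>.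
        t_cov (V N \<omega>) (mu N \<omega>) / graph_volume (V N \<omega>) (mu N \<omega>) \<ge> c6 * r N * ln (v N))"
      by blast
  next
    fix c1 c2 c4 c5 :: real and v r :: "nat \<Rightarrow> real"
    assume c: "c1 > 0" "c2 > 0" "c4 > 0" "c5 > 0" and r: "\<forall>N. v N \<ge> 0 \<and> r N \<ge> 0"
      and v: "filterlim v at_top sequentially"
      and H1: "whp M (\<lambda>N \<omega>. ln (card (V N \<omega>)) \<le> c1 * ln (v N) \<and>
        diam_R (V N \<omega>) (mu N \<omega>) \<le> c2 * r N)"
      and H2: "whp M (\<lambda>N \<omega>. ln (real (n_pac (V N \<omega>) (mu N \<omega>) (c4 * r N))) \<ge> c5 * ln (v N))"
    let ?ratio = "\<lambda>N \<omega>. t_cov (V N \<omega>) (mu N \<omega>) /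
      (t_hit (V N \<omega>) (mu N \<omega>) * ln (card (V N \<omega>)))"
    \<comment> \<open>Beyond the threshold from \<open>cover_ratio_bounds\<close> the
      \<open>liminf\<close> is exactly 1, so the limit in \<open>l\<close> is that of an eventually
      constant function.\<close>
    have "liminf (\<lambda>N. ereal (inner_prob M {\<omega> \<in> space M. 1 / l \<le> ?ratio N \<omega> \<and> ?ratio N \<omega> \<le> 2}))
        = ereal 1" if "l \<ge> 4 * c1 * c2 / (c4 * c5)" for l
    proof -
      have "whp M (\<lambda>N \<omega>. 1 / l \<le> ?ratio N \<omega> \<and> ?ratio N \<omega> \<le> 2)"
      proof (rule whp_mono[OF whp_conj[OF net whp_conj[OF H1 H2]]],
          use mult_ln_ge[OF v c(4), of 2] in eventually_elim)
        case (elim N)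
        then show ?case using cover_ratio_bounds[OF _ c _ elim _ _ _ that] r by blast
      qed
      then show ?thesis
        unfolding whp_def by (intro lim_imp_Liminf tendsto_ereal) auto
    qed
    then show "type1 M V mu"
      unfolding type1_def
      by (intro tendsto_eventually eventually_at_top_linorderI[of "4 * c1 * c2 / (c4 * c5)"])
  qed
qed

end
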